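(* Let $(\xi_n)_{n\in\mathbb{Z}}$ be a stationary ergodic Markov chain with state space $(S,\mathcal{A})$, marginal distribution $\pi$ and Markov operator $Q$. Let $f\in\mathbb{L}_2^0(\pi)$, $X_i=f(\xi_i)$, $S_n=\sum_{i=1}^n X_i$. For integers $m,k\ge 1$ put $f_m=\frac1m(Q+\dots+Q^m)f$ and $\bar R_k^m=\sum_{j=1}^k f_m(\xi_j)$. Assume that for every $\varepsilon>0$ $$\lim_{m\to\infty}\limsup_{n\to\infty}\mathbb{P}^x\Big(\frac{|\bar R_n^m|}{\sqrt n}>\varepsilon\Big)=0\quad\text{for }\pi\text{-almost every }x .$$ Then the quenched CLT holds: there are a constant $\sigma\in[0,\infty)$ and a set $S'\subset S$ with $\pi(S')=1$ such that for every $x\in S'$, $S_n/\sqrt n\Rightarrow \sigma N(0,1)$ under $\mathbb{P}^x$ as $n\to\infty$.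
   Context: Setting: $(\xi_n)_{n\in\mathbb{Z}}$ is a stationary Markov chain on a probability space $(\Omega,\mathcal{F},\mathbb{P})$ with values in a measurable space $(S,\mathcal{A})$, $\pi(A)=\mathbb{P}(\xi_0\in A)$, with regular conditional distribution (transition kernel) $Q(x,A)=\mathbb{P}(\xi_1\in A\mid\xi_0=x)$; $Q$ also denotes the operator $(Qf)(x)=\int_S f(s)\,Q(x,ds)$. The chain is constructed canonically on the space of $S$-valued sequences with $\xi_n$ the coordinate maps, and is assumed ergodic (the shift is ergodic under $\mathbb{P}$). $\mathbb{L}_p^0(\pi)$ is the set of measurable real functions $f$ on $S$ with $\int|f|^p\,d\pi<\infty$ and $\int f\,d\pi=0$. $\mathbb{P}^x$ is the law of the chain with transition kernel $Q$ started at $\xi_0=x$ (initial distribution $\delta_x$); $\mathbb{P}(A)=\int\mathbb{P}^x(A)\,\pi(dx)$. $\Rightarrow$ denotes convergence in distribution; $N(0,1)$ denotes a standard normal variable. *)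

theory Defs
  imports "HOL-Probability.Probability"
begin

definition shift :: "(int \<Rightarrow> 'a) \<Rightarrow> int \<Rightarrow> 'a" where
  "shift \<omega> = (\<lambda>n. \<omega> (n + 1))"

text \<open>The sigma-algebra generated by the coordinates \<open>\<xi>\<^sub>j\<close> with \<open>j \<le> n\<close>, realised as the
  pullback of the product sigma-algebra under restriction to \<open>{..n}\<close>.\<close>

definition past :: "'a measure \<Rightarrow> int \<Rightarrow> (int \<Rightarrow> 'a) measure" where
  "past S n = vimage_algebra (space (PiM UNIV (\<lambda>_. S))) (\<lambda>\<omega>. restrict \<omega> {..n}) (PiM {..n} (\<lambda>_. S))"

lemma subalgebra_past:
  assumes "sets P = sets (PiM UNIV (\<lambda>_. S))"
  shows "subalgebra P (past S n)"
proof -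
  let ?M = "PiM UNIV (\<lambda>_. S)"
  have sp: "space P = space ?M"
    by (rule sets_eq_imp_space_eq[OF assms])
  have *: "(\<lambda>\<omega>. restrict \<omega> {..n}) \<in> measurable ?M (PiM {..n} (\<lambda>_. S))"
    by (rule measurable_restrict_subset) simp
  have "sets (past S n) \<subseteq> sets ?M"
    unfolding past_def
    by (subst sets_vimage_algebra2) (use measurable_space[OF *] measurable_sets[OF *] in blast)+
  then show ?thesis
    by (simp add: subalgebra_def past_def sp assms)
qed

text \<open>The chain is given on the canonical space of two-sided sequences: \<open>P\<close> is its law and
  \<open>\<xi>\<^sub>n\<close> is the coordinate map \<open>\<lambda>\<omega>. \<omega> n\<close>.\<close>

locale stationary_ergodic_markov_chain = prob_space P
  for P :: "(int \<Rightarrow> 'a) measure" +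
  fixes S :: "'a measure" and \<pi> :: "'a measure" and Q :: "'a \<Rightarrow> 'a measure"
  assumes sets_P: "sets P = sets (PiM UNIV (\<lambda>_. S))"
    and marginal: "\<pi> = distr P S (\<lambda>\<omega>. \<omega> 0)"
    and kernel: "Q \<in> measurable S (prob_algebra S)"
    and markov: "\<And>n A. A \<in> sets S \<Longrightarrow>
      AE \<omega> in P. real_cond_exp P (past S n) (\<lambda>\<omega>'. indicator A (\<omega>' (n + 1))) \<omega> = measure (Q (\<omega> n)) A"
    and stationary: "distr P P shift = P"
    and ergodic: "\<And>A. A \<in> sets P \<Longrightarrow> shift -` A \<inter> space P = A \<Longrightarrow> prob A = 0 \<or> prob A = 1"

text \<open>The transition kernels fed to the Ionescu-Tulcea construction for the chain started at
  \<open>x\<close>: coordinate \<open>0\<close> is \<open>x\<close>, and coordinate \<open>j + 1\<close> is drawn from \<open>Q\<close> at coordinate \<open>j\<close>.\<close>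

definition chain_step :: "'a measure \<Rightarrow> ('a \<Rightarrow> 'a measure) \<Rightarrow> 'a \<Rightarrow> nat \<Rightarrow> (nat \<Rightarrow> 'a) \<Rightarrow> 'a measure" where
  "chain_step S Q x i \<omega> = (case i of 0 \<Rightarrow> return S x | Suc j \<Rightarrow> Q (\<omega> j))"

lemma Ionescu_Tulcea_chain_step:
  assumes Q: "Q \<in> measurable S (prob_algebra S)" and x: "x \<in> space S"
  shows "Ionescu_Tulcea (chain_step S Q x) (\<lambda>_. S)"
proof (rule Ionescu_Tulcea.intro)
  fix i
  have sub: "Q \<in> measurable S (subprob_algebra S)"
    by (rule measurable_prob_algebraD[OF Q])
  show "chain_step S Q x i \<in> measurable (PiM {0..<i} (\<lambda>_. S)) (subprob_algebra S)"
  proof (cases i)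
    case 0
    have "return S x \<in> space (subprob_algebra S)"
      by (rule measurable_space[OF return_measurable x])
    then show ?thesis
      by (simp add: 0 chain_step_def[abs_def])
  next
    case (Suc j)
    have "(\<lambda>\<omega>. Q (\<omega> j)) \<in> measurable (PiM {0..<Suc j} (\<lambda>_. S)) (subprob_algebra S)"
      by (rule measurable_compose[OF _ sub]) (rule measurable_component_singleton, simp)
    then show ?thesis
      by (simp add: Suc chain_step_def[abs_def])
  qed
next
  fix i and \<omega> :: "nat \<Rightarrow> 'a"
  assume w: "\<omega> \<in> space (PiM {0..<i} (\<lambda>_. S))"
  show "prob_space (chain_step S Q x i \<omega>)"
  proof (cases i)
    case 0
    then show ?thesis
      using x by (simp add: chain_step_def prob_space_return)
  next
    case (Suc j)
    then have "\<omega> j \<in> space S"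
      using w by (auto simp: space_PiM PiE_iff)
    from measurable_space[OF Q this] show ?thesis
      by (simp add: Suc chain_step_def space_prob_algebra)
  qed
qed

text \<open>The law of the chain started at \<open>x\<close>, on one-sided sequences.\<close>

definition chain_law :: "'a measure \<Rightarrow> ('a \<Rightarrow> 'a measure) \<Rightarrow> 'a \<Rightarrow> (nat \<Rightarrow> 'a) measure" where
  "chain_law S Q x =
    projective_family.lim UNIV (Ionescu_Tulcea.CI (chain_step S Q x) (\<lambda>_. S)) (\<lambda>_. S)"

definition L2_0 :: "'a measure \<Rightarrow> ('a \<Rightarrow> real) set" where
  "L2_0 \<pi> = {f \<in> borel_measurable \<pi>. integrable \<pi> (\<lambda>x. (f x)\<^sup>2) \<and> (\<integral>x. f x \<partial>\<pi>) = 0}"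

text \<open>Where \<open>f\<close> is not \<open>Q x\<close>-integrable, the Bochner integral has value \<open>0\<close>; for \<open>f\<close> in \<open>L2_0 \<pi>\<close>
  and \<open>Q\<close> preserving \<open>\<pi>\<close> this concerns only a \<open>\<pi>\<close>-null set of \<open>x\<close>, also for the iterates.\<close>

definition markov_op :: "('a \<Rightarrow> 'a measure) \<Rightarrow> ('a \<Rightarrow> real) \<Rightarrow> 'a \<Rightarrow> real" where
  "markov_op Q f x = (\<integral>s. f s \<partial>Q x)"

definition avg :: "('a \<Rightarrow> 'a measure) \<Rightarrow> ('a \<Rightarrow> real) \<Rightarrow> nat \<Rightarrow> 'a \<Rightarrow> real" where
  "avg Q f m x = (\<Sum>i=1..m. (markov_op Q ^^ i) f x) / real m"

definition partial_sum :: "('a \<Rightarrow> real) \<Rightarrow> nat \<Rightarrow> (nat \<Rightarrow> 'a) \<Rightarrow> real" where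
  "partial_sum g n \<omega> = (\<Sum>i=1..n. g (\<omega> i))"

end

theory Submission
  imports Defs
begin

text \<open>
The partial sums are split into a martingale and a remainder in such a way that the remainder is
exactly the quantity which the hypothesis controls. Fix \<open>m \<ge> 1\<close> and let
\<open>\<theta> = (\<Sum>i=1..m. \<Sum>j<i. Q\<^sup>j f) / m\<close> (the \<open>corrector\<close>). Telescoping gives
\<open>\<theta> - Q \<theta> = f - f\<^sub>m\<close> almost everywhere (\<open>poisson_equation\<close>), so that along a path
\<open>S\<^sub>n = R\<^sub>n + (\<Sum>j<n. \<theta> (\<xi>\<^sub>j\<^sub>+\<^sub>1) - Q \<theta> (\<xi>\<^sub>j)) + Q \<theta> (\<xi>\<^sub>0) - Q \<theta> (\<xi>\<^sub>n)\<close>, where \<open>R\<^sub>n\<close> is the sum of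
\<open>f\<^sub>m (\<xi>\<^sub>j)\<close> over \<open>1 \<le> j \<le> n\<close>.
The boundary terms are \<open>o(\<surd>n)\<close>, because the averages of \<open>(Q \<theta>)\<^sup>2\<close> along a path converge
(\<open>quenched_boundary_vanishes\<close>).

The sum in the middle is a martingale whose conditional variances are a fixed integrable function
\<open>v\<close> of the states visited. By Birkhoff's theorem (\<open>birkhoff_ergodic\<close>) their averages converge almost
surely to \<open>\<sigma>\<^sub>m\<^sup>2 = \<integral> v d\<pi>\<close>. This holds for the stationary chain, but the law of the stationary
chain on the nonnegative times is the \<open>\<pi>\<close>-mixture of the laws of the chains started at a point
(\<open>distr_forward\<close>); hence it holds almost surely for the chain started at \<open>x\<close>, for almost every \<open>x\<close>.
The same applies to the error terms of a Lindeberg argument, and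
\<open>char_martingale_tendsto\<close> then gives the central limit theorem for the martingale under each such law
(\<open>quenched_martingale_clt\<close>), with a variance \<open>\<sigma>\<^sub>m\<^sup>2\<close> that does not depend on \<open>x\<close>.

It remains to let \<open>m\<close> tend to infinity (\<open>gaussian_char_of_approximation\<close>). The hypothesis says that,
for large \<open>m\<close> and then large \<open>n\<close>, the variable \<open>S\<^sub>n/\<surd>n\<close> is close in probability to a variable with
characteristic function near \<open>exp (- t\<^sup>2 \<sigma>\<^sub>m\<^sup>2/2)\<close>. So these numbers form a Cauchy sequence in \<open>m\<close> for
every \<open>t\<close>. A single good \<open>m\<close> keeps them away from \<open>0\<close> at some small \<open>t \<noteq> 0\<close>; therefore the variances
\<open>\<sigma>\<^sub>m\<^sup>2\<close> cannot escape to infinity and converge to a finite \<open>\<sigma>\<^sup>2\<close>, and Levy's continuity theorem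
concludes.
\<close>

section \<open>Birkhoff's ergodic theorem\<close>

text \<open>This is the maximum of the Birkhoff sums of length at most \<open>n\<close>, the empty sum included. The
recursion serves as the definition because the proof of the maximal ergodic lemma runs on it.\<close>

primrec max_birkhoff :: "('a \<Rightarrow> 'a) \<Rightarrow> ('a \<Rightarrow> real) \<Rightarrow> nat \<Rightarrow> 'a \<Rightarrow> real" where
  "max_birkhoff T f 0 x = 0"
| "max_birkhoff T f (Suc n) x = max 0 (f x + max_birkhoff T f n (T x))"

lemma max_birkhoff_nonneg: "0 \<le> max_birkhoff T f n x"
  by (cases n) auto

lemma max_birkhoff_mono: "max_birkhoff T f n x \<le> max_birkhoff T f (Suc n) x"
proof (induction n arbitrary: x)
  case (Suc n)
  from Suc[of "T x"] show ?case
    unfolding max_birkhoff.simps(2)[of T f n x] max_birkhoff.simps(2)[of T f "Suc n" x]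
    by linarith
qed auto

lemma max_birkhoff_mono_le: "k \<le> n \<Longrightarrow> max_birkhoff T f k x \<le> max_birkhoff T f n x"
proof (induction rule: dec_induct)
  case (step m)
  then show ?case using max_birkhoff_mono[of T f m x] by linarith
qed simp

lemma birkhoff_sum_Suc:
  "(\<Sum>i<Suc n. f ((T ^^ i) x)) = f x + (\<Sum>i<n. f ((T ^^ i) (T x)))" for f :: "'a \<Rightarrow> real"
  by (subst sum.lessThan_Suc_shift) (simp add: funpow_Suc_right del: funpow.simps)

lemma birkhoff_sum_le_max_birkhoff:
  "(\<Sum>i<n. f ((T ^^ i) x)) \<le> max_birkhoff T f n x"
proof (induction n arbitrary: x)
  case (Suc n)
  show ?case using Suc[of "T x"] unfolding birkhoff_sum_Suc max_birkhoff.simps by linarith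
qed auto

locale measure_preserving_map = prob_space M for M :: "'a measure" +
  fixes T :: "'a \<Rightarrow> 'a"
  assumes T [measurable]: "T \<in> measurable M M"
    and distr_T: "distr M M T = M"
begin

lemma integrable_T:
  fixes f :: "'a \<Rightarrow> real"
  assumes "integrable M f"
  shows "integrable M (\<lambda>x. f (T x))"
  using integrable_distr[OF T, of f] assms distr_T by simp

lemma integral_T:
  fixes f :: "'a \<Rightarrow> real"
  assumes [measurable]: "f \<in> borel_measurable M"
  shows "(\<integral>x. f (T x) \<partial>M) = (\<integral>x. f x \<partial>M)"
  using integral_distr[OF T, of f] distr_T by simp

lemma funpow_T: "T ^^ i \<in> measurable M M"
proof (induction i)
  case (Suc i)
  have "(\<lambda>x. T ((T ^^ i) x)) \<in> measurable M M"
    using Suc by measurable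
  then show ?case by (simp add: comp_def)
qed (simp add: id_def)

lemma integrable_max_birkhoff:
  assumes "integrable M f"
  shows "integrable M (max_birkhoff T f n)"
proof (induction n)
  case 0
  then show ?case by simp
next
  case (Suc n)
  have "integrable M (\<lambda>x. max 0 (f x + max_birkhoff T f n (T x)))"
    using assms integrable_T[OF Suc]
    by (intro Bochner_Integration.integrable_max Bochner_Integration.integrable_add) simp_all
  then show ?case by (simp add: fun_eq_iff cong: integrable_cong)
qed

text \<open>Garsia's argument: where the maximum \<open>M\<^sub>n\<close> is positive, it is \<open>f + M\<^sub>n\<^sub>-\<^sub>1 \<circ> T \<le> f + M\<^sub>n \<circ> T\<close>, and
\<open>M\<^sub>n - M\<^sub>n \<circ> T\<close> has integral \<open>0\<close> by invariance.\<close>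

lemma maximal_ergodic:
  assumes f: "integrable M f"
  shows "0 \<le> (\<integral>x. f x * indicator {x. 0 < max_birkhoff T f n x} x \<partial>M)"
proof -
  note [measurable] = borel_measurable_integrable[OF f]
    borel_measurable_integrable[OF integrable_max_birkhoff[OF f]]
  let ?m = "max_birkhoff T f n"
  have int: "integrable M ?m" "integrable M (\<lambda>x. ?m (T x))"
    using integrable_max_birkhoff[OF f] integrable_T by auto
  have "0 = (\<integral>x. ?m x - ?m (T x) \<partial>M)"
    using integral_T[of ?m] int by simp
  also have "\<dots> \<le> (\<integral>x. f x * indicator {x. 0 < ?m x} x \<partial>M)"
  proof (rule integral_mono)
    show "integrable M (\<lambda>x. f x * indicator {x. 0 < ?m x} x)"
    proof (rule Bochner_Integration.integrable_bound[OF f])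
      show "(\<lambda>x. f x * indicator {x. 0 < ?m x} x) \<in> borel_measurable M"
        by measurable
    qed (auto simp: indicator_def)
    fix x
    show "?m x - ?m (T x) \<le> f x * indicator {x. 0 < ?m x} x"
    proof (cases "0 < ?m x")
      case True
      then obtain k where k: "n = Suc k" by (cases n) auto
      have "?m x = f x + max_birkhoff T f k (T x)"
        using True unfolding k by (simp add: max_def split: if_splits)
      moreover have "max_birkhoff T f k (T x) \<le> ?m (T x)"
        unfolding k by (rule max_birkhoff_mono)
      ultimately show ?thesis using True by simp
    next
      case False
      then show ?thesis using max_birkhoff_nonneg[of T f n x] max_birkhoff_nonneg[of T f n "T x"] by simp
    qed
  qed (use int in auto)
  finally show ?thesis .
qed

lemma integral_nonneg_of_birkhoff_sum_pos:
  fixes f :: "'a \<Rightarrow> real"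
  assumes f: "integrable M f"
    and pos: "AE x in M. \<exists>n. 0 < (\<Sum>i<n. f ((T ^^ i) x))"
  shows "0 \<le> (\<integral>x. f x \<partial>M)"
proof -
  note [measurable] = borel_measurable_integrable[OF f]
  have [measurable]: "max_birkhoff T f n \<in> borel_measurable M" for n
    by (rule borel_measurable_integrable[OF integrable_max_birkhoff[OF f]])
  have "(\<lambda>n. \<integral>x. f x * indicator {x. 0 < max_birkhoff T f n x} x \<partial>M) \<longlonglongrightarrow> (\<integral>x. f x \<partial>M)"
  proof (rule integral_dominated_convergence[where w="\<lambda>x. \<bar>f x\<bar>"])
    show "AE x in M. (\<lambda>n. f x * indicator {x. 0 < max_birkhoff T f n x} x) \<longlonglongrightarrow> f x"
      using pos
    proof eventually_elim
      fix x assume "\<exists>n. 0 < (\<Sum>i<n. f ((T ^^ i) x))"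
      then obtain k where k: "0 < (\<Sum>i<k. f ((T ^^ i) x))" by (elim exE)
      have "0 < max_birkhoff T f n x" if "n \<ge> k" for n
        using k birkhoff_sum_le_max_birkhoff[of f T x k] max_birkhoff_mono_le[OF that, of T f x]
        by linarith
      then have "\<forall>\<^sub>F n in sequentially. f x * indicator {x. 0 < max_birkhoff T f n x} x = f x"
        by (intro eventually_sequentiallyI[of k]) simp
      then show "(\<lambda>n. f x * indicator {x. 0 < max_birkhoff T f n x} x) \<longlonglongrightarrow> f x"
        by (rule tendsto_eventually)
    qed
    show "integrable M (\<lambda>x. \<bar>f x\<bar>)" using f by (rule integrable_abs)
    show "(\<lambda>x. f x * indicator {x. 0 < max_birkhoff T f n x} x) \<in> borel_measurable M" for n
      by measurable
    show "AE x in M. norm (f x * indicator {x. 0 < max_birkhoff T f n x} x) \<le> \<bar>f x\<bar>" for n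
      by (intro AE_I2) (simp add: indicator_def)
  qed measurable
  then show ?thesis
    by (rule LIMSEQ_le_const) (intro exI allI impI maximal_ergodic f)
qed

end

locale ergodic_map = measure_preserving_map +
  assumes ergodic_T: "\<And>A. A \<in> sets M \<Longrightarrow> T -` A \<inter> space M = A \<Longrightarrow> prob A = 0 \<or> prob A = 1"
begin

text \<open>The set where the sums are unbounded above is strictly invariant, since passing from \<open>x\<close> to \<open>T x\<close>
changes them by the single number \<open>f x\<close>. If it had full measure, some sum would be positive almost
everywhere, and the maximal ergodic lemma would make the integral nonnegative.\<close>

lemma birkhoff_sums_bounded_above:
  assumes f: "integrable M f" and neg: "(\<integral>x. f x \<partial>M) < 0"
  shows "AE x in M. \<exists>C::nat. \<forall>n. (\<Sum>i<n. f ((T ^^ i) x)) \<le> real C"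
proof -
  note [measurable] = borel_measurable_integrable[OF f]
  define A where "A = {x\<in>space M. \<forall>C::nat. \<exists>n. real C < (\<Sum>i<n. f ((T ^^ i) x))}"
  have [measurable]: "(\<lambda>x. f ((T ^^ i) x)) \<in> borel_measurable M" for i
    by (rule measurable_compose[OF funpow_T]) simp
  have A [measurable]: "A \<in> sets M"
    unfolding A_def by measurable
  have "T -` A \<inter> space M = A"
  proof (intro set_eqI iffI)
    fix x assume "x \<in> T -` A \<inter> space M"
    then have x: "x \<in> space M" and *: "\<And>C::nat. \<exists>n. real C < (\<Sum>i<n. f ((T ^^ i) (T x)))"
      by (auto simp: A_def)
    have "\<exists>n. real C < (\<Sum>i<n. f ((T ^^ i) x))" for C :: nat
    proof -
      obtain D :: nat where D: "real C + \<bar>f x\<bar> < D" using reals_Archimedean2[of "real C + \<bar>f x\<bar>"] by blast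
      obtain n where n: "real D < (\<Sum>i<n. f ((T ^^ i) (T x)))" using *[of D] by blast
      show ?thesis
        by (rule exI[of _ "Suc n"], subst birkhoff_sum_Suc) (use n D in linarith)
    qed
    then show "x \<in> A" using x by (simp add: A_def)
  next
    fix x assume "x \<in> A"
    then have x: "x \<in> space M" and *: "\<And>C::nat. \<exists>n. real C < (\<Sum>i<n. f ((T ^^ i) x))"
      by (auto simp: A_def)
    have "\<exists>n. real C < (\<Sum>i<n. f ((T ^^ i) (T x)))" for C :: nat
    proof -
      obtain D :: nat where D: "real C + \<bar>f x\<bar> < D" using reals_Archimedean2[of "real C + \<bar>f x\<bar>"] by blast
      obtain n where n: "real D < (\<Sum>i<n. f ((T ^^ i) x))" using *[of D] by blast
      then obtain k where k: "n = Suc k" using D by (cases n) auto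
      show ?thesis
        by (rule exI[of _ k]) (use n D in \<open>unfold k birkhoff_sum_Suc, linarith\<close>)
    qed
    moreover have "T x \<in> space M" using measurable_space[OF T x] .
    ultimately show "x \<in> T -` A \<inter> space M" using x by (simp add: A_def)
  qed
  then consider "prob A = 0" | "prob A = 1" using ergodic_T[OF A] by auto
  then show ?thesis
  proof cases
    case 1
    then have "AE x in M. x \<notin> A" by (simp add: AE_iff_measurable[OF A] prob_eq_0)
    then show ?thesis
      by (rule AE_mp) (auto simp: A_def not_less intro!: AE_I2)
  next
    case 2
    then have "AE x in M. x \<in> A" by (simp add: prob_eq_1)
    then have "AE x in M. \<exists>n. 0 < (\<Sum>i<n. f ((T ^^ i) x))"
    proof eventually_elim
      fix x assume "x \<in> A"
      then have "\<exists>n. real 0 < (\<Sum>i<n. f ((T ^^ i) x))"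
        unfolding A_def by blast
      then show "\<exists>n. 0 < (\<Sum>i<n. f ((T ^^ i) x))" by simp
    qed
    from integral_nonneg_of_birkhoff_sum_pos[OF f this] neg show ?thesis by simp
  qed
qed

text \<open>For a level \<open>b\<close> strictly between the integral and \<open>a\<close>, the function \<open>f - b\<close> has bounded sums.\<close>

lemma birkhoff_averages_limsup:
  assumes f: "integrable M f" and a: "(\<integral>x. f x \<partial>M) < a"
  shows "AE x in M. \<forall>\<^sub>F n in sequentially. (\<Sum>i<n. f ((T ^^ i) x)) / real n < a"
proof -
  define b where "b = ((\<integral>x. f x \<partial>M) + a) / 2"
  have b: "(\<integral>x. f x \<partial>M) < b" "b < a" using a by (simp_all add: b_def)
  have "integrable M (\<lambda>x. f x - b)"
    by (intro Bochner_Integration.integrable_diff f integrable_const)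
  moreover have "(\<integral>x. f x - b \<partial>M) < 0"
    using b by (subst Bochner_Integration.integral_diff[OF f integrable_const]) (simp add: prob_space)
  ultimately have "AE x in M. \<exists>C::nat. \<forall>n. (\<Sum>i<n. f ((T ^^ i) x) - b) \<le> real C"
    by (rule birkhoff_sums_bounded_above[of "\<lambda>x. f x - b"])
  then show ?thesis
  proof eventually_elim
    case (elim x)
    then obtain C :: nat where C: "\<forall>n. (\<Sum>i<n. f ((T ^^ i) x) - b) \<le> real C" by (elim exE)
    have "(\<lambda>n. C / real n) \<longlonglongrightarrow> 0" by (rule lim_const_over_n)
    then have "\<forall>\<^sub>F n in sequentially. C / real n < a - b"
      by (rule order_tendstoD) (use b in simp)
    then show ?case
      using eventually_gt_at_top[of 0]
    proof eventually_elim
      case (elim n)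
      have "(\<Sum>i<n. f ((T ^^ i) x)) \<le> C + b * n" using C[rule_format, of n] by (simp add: sum_subtractf mult.commute)
      moreover have "real C < (a - b) * n" using elim by (simp add: field_simps)
      ultimately have "(\<Sum>i<n. f ((T ^^ i) x)) < a * n" by (simp add: algebra_simps)
      then show ?case using elim by (simp add: field_simps)
    qed
  qed
qed

theorem birkhoff_ergodic:
  assumes f: "integrable M f"
  shows "AE x in M. (\<lambda>n. (\<Sum>i<n. f ((T ^^ i) x)) / real n) \<longlonglongrightarrow> (\<integral>x. f x \<partial>M)"
proof -
  let ?I = "\<integral>x. f x \<partial>M"
  have 1: "AE x in M. \<forall>k::nat. \<forall>\<^sub>F n in sequentially. (\<Sum>i<n. f ((T ^^ i) x)) / real n < ?I + 1 / Suc k"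
    unfolding AE_all_countable by (intro allI birkhoff_averages_limsup[OF f]) simp
  have "integrable M (\<lambda>x. - f x)" using f by simp
  note upper = birkhoff_averages_limsup[OF this]
  have 2: "AE x in M. \<forall>k::nat. \<forall>\<^sub>F n in sequentially. (\<Sum>i<n. - f ((T ^^ i) x)) / real n < - ?I + 1 / Suc k"
    unfolding AE_all_countable by (intro allI upper) simp
  from 1 2 show ?thesis
  proof eventually_elim
    case (elim x)
    show ?case
    proof (rule tendstoI)
      fix e :: real assume "0 < e"
      then obtain k where k: "1 / Suc k < e" using nat_approx_posE by blast
      show "\<forall>\<^sub>F n in sequentially. dist ((\<Sum>i<n. f ((T ^^ i) x)) / real n) ?I < e"
        using elim(1)[rule_format, of k] elim(2)[rule_format, of k]
        by eventually_elim (use k in \<open>auto simp: dist_real_def sum_negf\<close>)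
    qed
  qed
qed

end

section \<open>The law of the chain started at a point\<close>

text \<open>Freezing the coordinates after time \<open>k\<close> at the initial state is a measurable map from paths to paths
which forgets exactly the future. A function of the path depends on the times up to \<open>k\<close> only if it is
invariant under this map; thus finite prefixes need no product spaces of their own.\<close>

definition freeze :: "nat \<Rightarrow> (nat \<Rightarrow> 'a) \<Rightarrow> nat \<Rightarrow> 'a" where
  "freeze k \<omega> = (\<lambda>i. if i \<le> k then \<omega> i else \<omega> 0)"

lemma measurable_freeze:
  assumes "{0..k} \<subseteq> I"
  shows "freeze k \<in> measurable (PiM I (\<lambda>_. S)) (PiM UNIV (\<lambda>_. S))"
  unfolding freeze_def[abs_def]
proof (rule measurable_PiM_single')
  show "(\<lambda>\<omega>. if i \<le> k then \<omega> i else \<omega> 0) \<in> measurable (PiM I (\<lambda>_. S)) S" for i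
    using assms by (cases "i \<le> k") (auto intro!: measurable_component_singleton)
next
  have "i \<le> k \<Longrightarrow> i \<in> I" for i using assms by auto
  then show "(\<lambda>\<omega> i. if i \<le> k then \<omega> i else \<omega> 0) \<in> space (PiM I (\<lambda>_. S)) \<rightarrow> (\<Pi>\<^sub>E i\<in>UNIV. space S)"
    by (auto simp: space_PiM PiE_iff)
qed

lemma measurable_freeze_UNIV [measurable]:
  "freeze k \<in> measurable (PiM UNIV (\<lambda>_. S)) (PiM UNIV (\<lambda>_. S))"
  by (rule measurable_freeze) simp

lemma freeze_eqI: "(\<And>i. i \<le> k \<Longrightarrow> \<omega> i = \<omega>' i) \<Longrightarrow> freeze k \<omega> = freeze k \<omega>'"
  by (auto simp: freeze_def fun_eq_iff)

text \<open>The Markov property as an identity of measures: the path up to time \<open>n + 1\<close> arises by appending to the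
path up to time \<open>n\<close> a state drawn from \<open>Q\<close> at the state at time \<open>n\<close>. The initial law is left open.\<close>

definition markov_law :: "'a measure \<Rightarrow> ('a \<Rightarrow> 'a measure) \<Rightarrow> (nat \<Rightarrow> 'a) measure \<Rightarrow> bool" where
  "markov_law S Q M \<longleftrightarrow> prob_space M \<and> sets M = sets (PiM UNIV (\<lambda>_. S)) \<and>
    (\<forall>n. distr M (PiM UNIV (\<lambda>_. S)) (freeze (Suc n)) =
       M \<bind> (\<lambda>\<omega>. distr (Q (\<omega> n)) (PiM UNIV (\<lambda>_. S)) (\<lambda>y. freeze (Suc n) (fun_upd \<omega> (Suc n) y))))"

locale markov_kernel =
  fixes S :: "'a measure" and Q :: "'a \<Rightarrow> 'a measure"
  assumes Q_prob_algebra: "Q \<in> measurable S (prob_algebra S)"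
begin

abbreviation paths :: "(nat \<Rightarrow> 'a) measure" where
  "paths \<equiv> PiM UNIV (\<lambda>_. S)"

lemma Q_subprob [measurable]: "Q \<in> measurable S (subprob_algebra S)"
  by (rule measurable_prob_algebraD[OF Q_prob_algebra])

lemma prob_space_Q: "x \<in> space S \<Longrightarrow> prob_space (Q x)"
  using measurable_space[OF Q_prob_algebra] by (simp add: space_prob_algebra)

lemma sets_Q [simp]: "x \<in> space S \<Longrightarrow> sets (Q x) = sets S"
  using measurable_space[OF Q_prob_algebra] by (simp add: space_prob_algebra)

lemma space_Q [simp]: "x \<in> space S \<Longrightarrow> space (Q x) = space S"
  using sets_Q sets_eq_imp_space_eq by blast

lemma measurable_Q: "x \<in> space S \<Longrightarrow> measurable (Q x) N = measurable S N"
  by (rule measurable_cong_sets) simp_all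

lemma prefix_chain_law:
  assumes x: "x \<in> space S"
  shows "distr (chain_law S Q x) (PiM {0..<k} (\<lambda>_. S)) (\<lambda>\<omega>. restrict \<omega> {0..<k}) =
    Ionescu_Tulcea.C (chain_step S Q x) (\<lambda>_. S) 0 k (\<lambda>_. undefined)"
proof -
  interpret IT: Ionescu_Tulcea "chain_step S Q x" "\<lambda>_. S"
    by (rule Ionescu_Tulcea_chain_step[OF Q_prob_algebra x])
  have up: "IT.up_to {0..<k} = k"
    unfolding IT.up_to_def by (rule Least_equality) (auto simp: not_le[symmetric])
  show ?thesis
    using IT.distr_lim[of "{0..<k}"] IT.distr_C[of k k "\<lambda>_. undefined" 0]
    by (simp add: IT.CI_def up chain_law_def)
qed

lemma sets_chain_law:
  assumes x: "x \<in> space S"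
  shows "sets (chain_law S Q x) = sets paths"
proof -
  interpret IT: Ionescu_Tulcea "chain_step S Q x" "\<lambda>_. S"
    by (rule Ionescu_Tulcea_chain_step[OF Q_prob_algebra x])
  show ?thesis unfolding chain_law_def by (rule IT.PF.sets_lim)
qed


lemma space_chain_law: "x \<in> space S \<Longrightarrow> space (chain_law S Q x) = space paths"
  using sets_chain_law sets_eq_imp_space_eq by blast

lemma measurable_chain_law: "x \<in> space S \<Longrightarrow> measurable (chain_law S Q x) N = measurable paths N"
  by (rule measurable_cong_sets) (simp_all add: sets_chain_law)

lemma prob_space_chain_law:
  assumes x: "x \<in> space S"
  shows "prob_space (chain_law S Q x)"
proof -
  interpret IT: Ionescu_Tulcea "chain_step S Q x" "\<lambda>_. S"
    by (rule Ionescu_Tulcea_chain_step[OF Q_prob_algebra x])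
  have "prob_space (IT.C 0 0 (\<lambda>_. undefined))"
    by (rule IT.prob_space_C) simp
  then have "prob_space (distr (chain_law S Q x) (PiM {0..<0} (\<lambda>_. S)) (\<lambda>\<omega>. restrict \<omega> {0..<0}))"
    unfolding prefix_chain_law[OF x] .
  then show ?thesis
    by (rule prob_space_distrD[rotated]) (simp add: measurable_chain_law x measurable_restrict_subset)
qed

lemma distr_chain_law_0:
  assumes x: "x \<in> space S"
  shows "distr (chain_law S Q x) S (\<lambda>\<omega>. \<omega> 0) = return S x"
proof -
  interpret IT: Ionescu_Tulcea "chain_step S Q x" "\<lambda>_. S"
    by (rule Ionescu_Tulcea_chain_step[OF Q_prob_algebra x])
  have u: "(\<lambda>_. undefined) \<in> space (PiM {} (\<lambda>_. S))" by (simp add: space_PiM)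
  have C1: "IT.C 0 1 (\<lambda>_. undefined) = IT.eP 0 (\<lambda>_. undefined)"
    using bind_return[OF IT.measurable_eP[of 0], of "\<lambda>_. undefined"] by (simp add: space_PiM)
  have "distr (chain_law S Q x) S (\<lambda>\<omega>. \<omega> 0) =
      distr (distr (chain_law S Q x) (PiM {0..<1} (\<lambda>_. S)) (\<lambda>\<omega>. restrict \<omega> {0..<1})) S (\<lambda>\<omega>. \<omega> 0)"
    by (subst distr_distr)
       (auto simp: comp_def measurable_chain_law x intro!: measurable_restrict_subset measurable_component_singleton)
  also have "\<dots> = distr (IT.eP 0 (\<lambda>_. undefined)) S (\<lambda>\<omega>. \<omega> 0)"
    unfolding prefix_chain_law[OF x] C1 ..
  also have "\<dots> = distr (return S x) S (\<lambda>y. y)"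
    unfolding IT.eP_def
    by (subst distr_distr)
       (auto simp: comp_def chain_step_def intro!: measurable_component_singleton measurable_fun_upd[where J="{}"])
  also have "\<dots> = return S x"
    by (rule distr_id2) simp
  finally show ?thesis .
qed

lemma measurable_markov_step:
  "(\<lambda>\<omega>. distr (Q (\<omega> n)) paths (\<lambda>y. freeze (Suc n) (fun_upd \<omega> (Suc n) y)))
    \<in> measurable paths (subprob_algebra paths)"
proof (rule measurable_distr2[where M=S])
  have "(\<lambda>p. fun_upd (fst p) (Suc n) (snd p)) \<in> measurable (paths \<Otimes>\<^sub>M S) paths"
    by (rule measurable_fun_upd[where J=UNIV]) auto
  then have "(\<lambda>p. freeze (Suc n) (fun_upd (fst p) (Suc n) (snd p))) \<in> measurable (paths \<Otimes>\<^sub>M S) paths"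
    by measurable
  then show "(\<lambda>(\<omega>, y). freeze (Suc n) (fun_upd \<omega> (Suc n) y)) \<in> measurable (paths \<Otimes>\<^sub>M S) paths"
    by (simp add: split_beta')
  show "(\<lambda>\<omega>. Q (\<omega> n)) \<in> measurable paths (subprob_algebra S)"
    by (rule measurable_compose[OF _ Q_subprob]) (rule measurable_component_singleton, simp)
qed

text \<open>The Markov property is the last composition step in the construction of the prefix of length \<open>n + 2\<close>.\<close>

theorem markov_law_chain_law:
  assumes x: "x \<in> space S"
  shows "markov_law S Q (chain_law S Q x)"
  unfolding markov_law_def
proof (intro conjI allI)
  interpret IT: Ionescu_Tulcea "chain_step S Q x" "\<lambda>_. S"
    by (rule Ionescu_Tulcea_chain_step[OF Q_prob_algebra x])
  let ?M = "chain_law S Q x" and ?u = "\<lambda>_. undefined :: 'a"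
  let ?P = "\<lambda>k::nat. PiM {0..<k} (\<lambda>_. S)" and ?r = "\<lambda>(k::nat) \<omega>. restrict \<omega> {0..<k}"
  show "prob_space ?M" "sets ?M = sets paths"
    using prob_space_chain_law sets_chain_law x by auto
  have ne: "space ?M \<noteq> {}"
    using prob_space.not_empty prob_space_chain_law x by blast
  fix n
  let ?fr = "freeze (Suc n) :: (nat \<Rightarrow> 'a) \<Rightarrow> _"
  have [measurable]: "?fr \<in> measurable (?P (Suc (Suc n))) paths"
    by (rule measurable_freeze) auto
  have r [measurable]: "?r k \<in> measurable ?M (?P k)" for k
    by (simp add: measurable_chain_law x measurable_restrict_subset)
  have "distr ?M paths ?fr = distr (distr ?M (?P (Suc (Suc n))) (?r (Suc (Suc n)))) paths ?fr"
    by (subst distr_distr) (auto intro!: distr_cong freeze_eqI)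
  also have "\<dots> = distr (IT.C 0 (Suc n) ?u \<bind> IT.eP (Suc n)) paths ?fr"
    unfolding prefix_chain_law[OF x] by simp
  also have "\<dots> = IT.C 0 (Suc n) ?u \<bind> (\<lambda>\<omega>. distr (IT.eP (Suc n) \<omega>) paths ?fr)"
  proof (rule distr_bind[where K="?P (Suc (Suc n))"])
    have u: "?u \<in> space (?P 0)" by (simp add: space_PiM)
    show "IT.eP (Suc n) \<in> measurable (IT.C 0 (Suc n) ?u) (subprob_algebra (?P (Suc (Suc n))))"
      using IT.measurable_eP[of "Suc n"] IT.sets_C[OF u, of "Suc n"]
      by (simp cong: measurable_cong_sets del: IT.C.simps)
    show "space (IT.C 0 (Suc n) ?u) \<noteq> {}"
      by (rule prob_space.not_empty[OF IT.prob_space_C[OF u]])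
  qed measurable
  also have "\<dots> = ?M \<bind> (\<lambda>\<omega>. distr (IT.eP (Suc n) (?r (Suc n) \<omega>)) paths ?fr)"
    unfolding prefix_chain_law[OF x, symmetric]
  proof (rule bind_distr[where K="paths"])
    show "(\<lambda>\<omega>. distr (IT.eP (Suc n) \<omega>) paths ?fr) \<in> measurable (?P (Suc n)) (subprob_algebra paths)"
      by (rule measurable_compose[OF IT.measurable_eP measurable_distr]) measurable
  qed (auto simp: ne)
  also have "\<dots> = ?M \<bind> (\<lambda>\<omega>. distr (Q (\<omega> n)) paths (\<lambda>y. ?fr (fun_upd \<omega> (Suc n) y)))"
  proof (rule bind_cong[OF refl])
    fix \<omega> assume "\<omega> \<in> space ?M"
    then have \<omega>: "\<omega> i \<in> space S" for i
      by (auto simp: space_chain_law x space_PiM)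
    have "fun_upd (?r (Suc n) \<omega>) (Suc n) \<in> measurable S (?P (Suc (Suc n)))"
      by (rule measurable_fun_upd[where J="{0..<Suc n}"]) (auto simp: space_PiM \<omega>)
    then have u: "fun_upd (?r (Suc n) \<omega>) (Suc n) \<in> measurable (Q (\<omega> n)) (?P (Suc (Suc n)))"
      unfolding measurable_Q[OF \<omega>] .
    have "chain_step S Q x (Suc n) (?r (Suc n) \<omega>) = Q (\<omega> n)"
      by (simp add: chain_step_def)
    then have "distr (IT.eP (Suc n) (?r (Suc n) \<omega>)) paths ?fr =
        distr (Q (\<omega> n)) paths (?fr \<circ> fun_upd (?r (Suc n) \<omega>) (Suc n))"
      unfolding IT.eP_def using u by (simp add: distr_distr del: restrict_fupd)
    also have "?fr \<circ> fun_upd (?r (Suc n) \<omega>) (Suc n) = (\<lambda>y. ?fr (fun_upd \<omega> (Suc n) y))"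
      by (auto simp: fun_eq_iff freeze_def)
    finally show "distr (IT.eP (Suc n) (?r (Suc n) \<omega>)) paths ?fr =
        distr (Q (\<omega> n)) paths (\<lambda>y. ?fr (fun_upd \<omega> (Suc n) y))" .
  qed
  finally show "distr ?M paths ?fr = ?M \<bind> (\<lambda>\<omega>. distr (Q (\<omega> n)) paths (\<lambda>y. ?fr (fun_upd \<omega> (Suc n) y)))" .
qed


lemma measurable_fun_upd_path:
  "\<omega> \<in> space paths \<Longrightarrow> fun_upd \<omega> (Suc n) \<in> measurable S paths"
  by (rule measurable_fun_upd[where J=UNIV]) auto

lemma path_in_space: "\<omega> \<in> space paths \<Longrightarrow> \<omega> i \<in> space S"
  by (auto simp: space_PiM)

context
  fixes M assumes M: "markov_law S Q M"
begin

lemma prob_space_markov_law: "prob_space M"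
  and sets_markov_law: "sets M = sets paths"
  using M by (auto simp: markov_law_def)

lemma space_markov_law: "space M = space paths"
  by (rule sets_eq_imp_space_eq[OF sets_markov_law])

lemma measurable_markov_law: "measurable M N = measurable paths N"
  by (rule measurable_cong_sets) (simp_all add: sets_markov_law)

lemma markov_step_measurable:
  "(\<lambda>\<omega>. distr (Q (\<omega> n)) paths (\<lambda>y. freeze (Suc n) (fun_upd \<omega> (Suc n) y)))
    \<in> measurable M (subprob_algebra paths)"
  using measurable_markov_step by (simp add: measurable_markov_law)

lemma markov_step_eq: "distr M paths (freeze (Suc n)) =
       M \<bind> (\<lambda>\<omega>. distr (Q (\<omega> n)) paths (\<lambda>y. freeze (Suc n) (fun_upd \<omega> (Suc n) y)))"
  using M by (simp add: markov_law_def)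

lemma nn_integral_markov_law:
  assumes [measurable]: "G \<in> borel_measurable paths"
    and dep: "\<And>\<omega>. G (freeze (Suc n) \<omega>) = G \<omega>"
  shows "(\<integral>\<^sup>+\<omega>. G \<omega> \<partial>M) = (\<integral>\<^sup>+\<omega>. (\<integral>\<^sup>+y. G (fun_upd \<omega> (Suc n) y) \<partial>Q (\<omega> n)) \<partial>M)"
proof -
  have "(\<integral>\<^sup>+\<omega>. G \<omega> \<partial>M) = (\<integral>\<^sup>+\<omega>. G \<omega> \<partial>distr M paths (freeze (Suc n)))"
    by (subst nn_integral_distr) (simp_all add: measurable_markov_law dep)
  also have "\<dots> = (\<integral>\<^sup>+\<omega>. \<integral>\<^sup>+\<omega>'. G \<omega>' \<partial>distr (Q (\<omega> n)) paths (\<lambda>y. freeze (Suc n) (fun_upd \<omega> (Suc n) y)) \<partial>M)"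
    unfolding markov_step_eq by (rule nn_integral_bind[OF _ markov_step_measurable]) measurable
  also have "\<dots> = (\<integral>\<^sup>+\<omega>. (\<integral>\<^sup>+y. G (fun_upd \<omega> (Suc n) y) \<partial>Q (\<omega> n)) \<partial>M)"
  proof (rule nn_integral_cong)
    fix \<omega> assume "\<omega> \<in> space M"
    then have [measurable]: "fun_upd \<omega> (Suc n) \<in> measurable S paths" and \<omega>: "\<omega> n \<in> space S"
      using measurable_fun_upd_path path_in_space by (auto simp: space_markov_law)
    show "(\<integral>\<^sup>+\<omega>'. G \<omega>' \<partial>distr (Q (\<omega> n)) paths (\<lambda>y. freeze (Suc n) (fun_upd \<omega> (Suc n) y))) =
        (\<integral>\<^sup>+y. G (fun_upd \<omega> (Suc n) y) \<partial>Q (\<omega> n))"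
      by (subst nn_integral_distr) (simp_all add: measurable_Q \<omega> dep)
  qed
  finally show ?thesis .
qed

lemma integral_markov_law_real:
  fixes G :: "(nat \<Rightarrow> 'a) \<Rightarrow> real"
  assumes [measurable]: "G \<in> borel_measurable paths"
    and dep: "\<And>\<omega>. G (freeze (Suc n) \<omega>) = G \<omega>"
    and bnd: "\<And>\<omega>. \<bar>G \<omega>\<bar> \<le> B"
  shows "integrable M (\<lambda>\<omega>. \<integral>y. G (fun_upd \<omega> (Suc n) y) \<partial>Q (\<omega> n))" (is ?int)
    "(\<integral>\<omega>. G \<omega> \<partial>M) = (\<integral>\<omega>. (\<integral>y. G (fun_upd \<omega> (Suc n) y) \<partial>Q (\<omega> n)) \<partial>M)" (is ?eq)
proof -
  interpret prob_space M by (rule prob_space_markov_law)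
  let ?K = "\<lambda>\<omega>. distr (Q (\<omega> n)) paths (\<lambda>y. freeze (Suc n) (fun_upd \<omega> (Suc n) y))"
  have *: "(\<integral>\<omega>'. G \<omega>' \<partial>?K \<omega>) = (\<integral>y. G (fun_upd \<omega> (Suc n) y) \<partial>Q (\<omega> n))"
    "emeasure (?K \<omega>) (space (?K \<omega>)) = 1" if "\<omega> \<in> space M" for \<omega>
  proof -
    from that have [measurable]: "fun_upd \<omega> (Suc n) \<in> measurable S paths" and \<omega>: "\<omega> n \<in> space S"
      using measurable_fun_upd_path path_in_space by (auto simp: space_markov_law)
    show "(\<integral>\<omega>'. G \<omega>' \<partial>?K \<omega>) = (\<integral>y. G (fun_upd \<omega> (Suc n) y) \<partial>Q (\<omega> n))"
      by (subst integral_distr) (simp_all add: measurable_Q \<omega> dep)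
    show "emeasure (?K \<omega>) (space (?K \<omega>)) = 1"
      by (intro prob_space.emeasure_space_1 prob_space.prob_space_distr prob_space_Q \<omega>)
        (simp add: measurable_Q \<omega>)
  qed
  have "(\<lambda>\<omega>. \<integral>\<omega>'. G \<omega>' \<partial>?K \<omega>) \<in> borel_measurable M"
    by (rule measurable_compose[OF markov_step_measurable integral_measurable_subprob_algebra]) simp
  then have meas: "(\<lambda>\<omega>. \<integral>y. G (fun_upd \<omega> (Suc n) y) \<partial>Q (\<omega> n)) \<in> borel_measurable M"
    by (rule measurable_cong[THEN iffD1, rotated]) (rule *(1))
  show ?int
  proof (rule integrable_const_bound[where B=B, OF _ meas], rule AE_I2)
    fix \<omega> assume "\<omega> \<in> space M"
    then have \<omega>: "\<omega> n \<in> space S" by (simp add: space_markov_law path_in_space)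
    interpret Q: prob_space "Q (\<omega> n)" by (rule prob_space_Q[OF \<omega>])
    have "\<bar>\<integral>y. G (fun_upd \<omega> (Suc n) y) \<partial>Q (\<omega> n)\<bar> \<le> (\<integral>y. \<bar>G (fun_upd \<omega> (Suc n) y)\<bar> \<partial>Q (\<omega> n))"
      by (rule integral_abs_bound)
    also have "\<dots> \<le> B"
    proof (cases "integrable (Q (\<omega> n)) (\<lambda>y. \<bar>G (fun_upd \<omega> (Suc n) y)\<bar>)")
      case True
      then show ?thesis by (rule Q.integral_le_const) (use bnd in auto)
    next
      case False
      then show ?thesis using bnd[of undefined] by (simp add: not_integrable_integral_eq)
    qed
    finally show "norm (\<integral>y. G (fun_upd \<omega> (Suc n) y) \<partial>Q (\<omega> n)) \<le> B" by simp
  qed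
  have kernel_bound: "AE \<omega> in M. emeasure (?K \<omega>) (space (?K \<omega>)) \<le> ennreal 1"
    by (rule AE_I2) (simp only: *(2) ennreal_1 order_refl)
  have "(\<integral>\<omega>. G \<omega> \<partial>M) = (\<integral>\<omega>. G \<omega> \<partial>distr M paths (freeze (Suc n)))"
    by (subst integral_distr) (simp_all add: measurable_markov_law dep)
  also have "\<dots> = (\<integral>\<omega>. \<integral>\<omega>'. G \<omega>' \<partial>?K \<omega> \<partial>M)"
    unfolding markov_step_eq
    by (rule integral_bind[where K=paths and B=B and B'=1, OF _ _ markov_step_measurable finite_measure_axioms])
       (use bnd kernel_bound in auto)
  also have "\<dots> = (\<integral>\<omega>. (\<integral>y. G (fun_upd \<omega> (Suc n) y) \<partial>Q (\<omega> n)) \<partial>M)"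
    by (rule Bochner_Integration.integral_cong[OF refl]) (rule *(1))
  finally show ?eq .
qed

text \<open>The only form of the Markov property that the central limit theorem needs: a bounded weight depending
on the past times a function of the next state.\<close>

lemma integral_markov_law:
  fixes F :: "(nat \<Rightarrow> 'a) \<Rightarrow> complex" and g :: "'a \<Rightarrow> complex"
  assumes [measurable]: "F \<in> borel_measurable paths" "g \<in> borel_measurable S"
    and dep: "\<And>\<omega> \<omega>'. (\<And>i. i \<le> n \<Longrightarrow> \<omega> i = \<omega>' i) \<Longrightarrow> F \<omega> = F \<omega>'"
    and F: "\<And>\<omega>. norm (F \<omega>) \<le> B" and g: "\<And>y. norm (g y) \<le> 1"
  shows "(\<integral>\<omega>. F \<omega> * g (\<omega> (Suc n)) \<partial>M) = (\<integral>\<omega>. F \<omega> * (\<integral>y. g y \<partial>Q (\<omega> n)) \<partial>M)"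
proof -
  interpret prob_space M by (rule prob_space_markov_law)
  let ?G = "\<lambda>\<omega>. F \<omega> * g (\<omega> (Suc n))"
  have Fu: "F (fun_upd \<omega> (Suc n) y) = F \<omega>" "F (freeze (Suc n) \<omega>) = F \<omega>" for \<omega> y
    by (auto intro!: dep simp: freeze_def)
  have Gu: "?G (fun_upd \<omega> (Suc n) y) = F \<omega> * g y" "?G (freeze (Suc n) \<omega>) = ?G \<omega>" for \<omega> y
    by (auto simp: Fu) (simp add: freeze_def)
  have B: "norm (?G \<omega>) \<le> B" for \<omega>
    unfolding norm_mult using mult_mono[OF F[of \<omega>] g[of "\<omega> (Suc n)"]] order_trans[OF norm_ge_zero F[of \<omega>]]
    by simp
  have G [measurable]: "?G \<in> borel_measurable paths"
    by measurable
  have intG: "integrable M ?G"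
    by (rule integrable_const_bound[where B=B]) (use B G in \<open>auto simp: measurable_markov_law\<close>)
  have Re_abs: "\<bar>Re (?G \<omega>)\<bar> \<le> B" "\<bar>Im (?G \<omega>)\<bar> \<le> B" for \<omega>
    using B[of \<omega>] abs_Re_le_cmod[of "?G \<omega>"] abs_Im_le_cmod[of "?G \<omega>"] by linarith+
  have ReG: "(\<lambda>\<omega>. Re (?G \<omega>)) \<in> borel_measurable paths" and ImG: "(\<lambda>\<omega>. Im (?G \<omega>)) \<in> borel_measurable paths"
    by measurable
  note re = integral_markov_law_real[where G="\<lambda>\<omega>. Re (?G \<omega>)" and B=B and n=n, OF ReG arg_cong[where f=Re, OF Gu(2)] Re_abs(1)]
  note im = integral_markov_law_real[where G="\<lambda>\<omega>. Im (?G \<omega>)" and B=B and n=n, OF ImG arg_cong[where f=Im, OF Gu(2)] Re_abs(2)]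
  let ?H = "\<lambda>\<omega>. F \<omega> * (\<integral>y. g y \<partial>Q (\<omega> n))"
  have H: "?H \<omega> = Complex (\<integral>y. Re (?G (fun_upd \<omega> (Suc n) y)) \<partial>Q (\<omega> n)) (\<integral>y. Im (?G (fun_upd \<omega> (Suc n) y)) \<partial>Q (\<omega> n))"
    if "\<omega> \<in> space M" for \<omega>
  proof -
    from that have \<omega>: "\<omega> n \<in> space S" by (simp add: space_markov_law path_in_space)
    interpret Q: prob_space "Q (\<omega> n)" by (rule prob_space_Q[OF \<omega>])
    have "integrable (Q (\<omega> n)) g"
      by (rule Q.integrable_const_bound[where B=1]) (auto simp: g measurable_Q \<omega>)
    then have int: "integrable (Q (\<omega> n)) (\<lambda>y. F \<omega> * g y)" by simp
    have "?H \<omega> = (\<integral>y. F \<omega> * g y \<partial>Q (\<omega> n))" by simp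
    also have "\<dots> = Complex (\<integral>y. Re (F \<omega> * g y) \<partial>Q (\<omega> n)) (\<integral>y. Im (F \<omega> * g y) \<partial>Q (\<omega> n))"
      unfolding complex_eq_iff complex.sel
      using integral_Re[OF int] integral_Im[OF int] by (simp only: )
    finally show ?thesis unfolding Gu .
  qed
  have "integrable M ?H \<longleftrightarrow> integrable M (\<lambda>\<omega>. Complex (\<integral>y. Re (?G (fun_upd \<omega> (Suc n) y)) \<partial>Q (\<omega> n)) (\<integral>y. Im (?G (fun_upd \<omega> (Suc n) y)) \<partial>Q (\<omega> n)))"
    by (rule Bochner_Integration.integrable_cong[OF refl]) (rule H)
  also have "\<dots>"
    unfolding Complex_eq using re(1) im(1)
    by (intro Bochner_Integration.integrable_add Bochner_Integration.integrable_mult_right integrable_of_real) auto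
  finally have intH: "integrable M ?H" .
  show ?thesis
    unfolding complex_eq_iff integral_Re[OF intG, symmetric] integral_Im[OF intG, symmetric]
      integral_Re[OF intH, symmetric] integral_Im[OF intH, symmetric] re(2) im(2)
    by (intro conjI Bochner_Integration.integral_cong refl) (simp_all only: H complex.sel)
qed

end

text \<open>The last factor of a product over the path can be integrated out, which leaves a product over a path that
is shorter by one step.\<close>

lemma nn_integral_chain_law_prod_Suc:
  fixes g :: "nat \<Rightarrow> 'a \<Rightarrow> ennreal"
  assumes [measurable]: "\<And>j. g j \<in> borel_measurable S" and x: "x \<in> space S"
  shows "(\<integral>\<^sup>+\<omega>. (\<Prod>j\<le>Suc n. g j (\<omega> j)) \<partial>chain_law S Q x) =
    (\<integral>\<^sup>+\<omega>. (\<Prod>j\<le>n. g j (\<omega> j)) * (\<integral>\<^sup>+y. g (Suc n) y \<partial>Q (\<omega> n)) \<partial>chain_law S Q x)"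
proof -
  have "(\<integral>\<^sup>+\<omega>. (\<Prod>j\<le>Suc n. g j (\<omega> j)) \<partial>chain_law S Q x) =
      (\<integral>\<^sup>+\<omega>. (\<integral>\<^sup>+y. (\<Prod>j\<le>Suc n. g j (fun_upd \<omega> (Suc n) y j)) \<partial>Q (\<omega> n)) \<partial>chain_law S Q x)"
  proof (rule nn_integral_markov_law[OF markov_law_chain_law[OF x]])
    show "(\<Prod>j\<le>Suc n. g j (freeze (Suc n) \<omega> j)) = (\<Prod>j\<le>Suc n. g j (\<omega> j))" for \<omega>
      by (rule prod.cong) (auto simp: freeze_def)
  qed measurable
  also have "\<dots> = (\<integral>\<^sup>+\<omega>. (\<Prod>j\<le>n. g j (\<omega> j)) * (\<integral>\<^sup>+y. g (Suc n) y \<partial>Q (\<omega> n)) \<partial>chain_law S Q x)"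
  proof (rule nn_integral_cong)
    fix \<omega> assume "\<omega> \<in> space (chain_law S Q x)"
    then have \<omega>: "\<omega> n \<in> space S" by (auto simp: space_chain_law x space_PiM)
    have "(\<Prod>j\<le>Suc n. g j (fun_upd \<omega> (Suc n) y j)) = (\<Prod>j\<le>n. g j (\<omega> j)) * g (Suc n) y" for y
      by (simp add: atMost_Suc mult.commute)
    then show "(\<integral>\<^sup>+y. (\<Prod>j\<le>Suc n. g j (fun_upd \<omega> (Suc n) y j)) \<partial>Q (\<omega> n)) =
        (\<Prod>j\<le>n. g j (\<omega> j)) * (\<integral>\<^sup>+y. g (Suc n) y \<partial>Q (\<omega> n))"
      by (simp only:) (rule nn_integral_cmult, simp add: measurable_Q \<omega>)
  qed
  finally show ?thesis .
qed

end

section \<open>The stationary chain as a mixture of chains started at a point\<close>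

context stationary_ergodic_markov_chain
begin

sublocale markov_kernel S Q
  by unfold_locales (rule kernel)

lemma sets_pi [simp]: "sets \<pi> = sets S" and space_pi [simp]: "space \<pi> = space S"
  by (simp_all add: marginal)

lemma space_P: "space P = space (PiM UNIV (\<lambda>_. S))"
  by (rule sets_eq_imp_space_eq[OF sets_P])

lemma measurable_pi: "measurable \<pi> N = measurable S N"
  by (rule measurable_cong_sets) simp_all

lemma measurable_coordinate [measurable]: "(\<lambda>\<omega>. \<omega> (j::int)) \<in> measurable P S"
  by (simp add: measurable_cong_sets[OF sets_P refl] measurable_component_singleton)

lemma prob_space_pi: "prob_space \<pi>"
  unfolding marginal by (rule prob_space_distr) measurable

lemma measurable_past_coordinate:
  assumes "j \<le> n"
  shows "(\<lambda>\<omega>. \<omega> j) \<in> measurable (past S n) S"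
proof -
  have "(\<lambda>\<omega>. restrict \<omega> {..n} j) \<in> measurable (past S n) S"
    unfolding past_def
    by (rule measurable_compose[OF measurable_vimage_algebra1 measurable_component_singleton])
      (use assms in \<open>auto simp: space_PiM PiE_iff split: if_splits\<close>)
  then show ?thesis using assms by simp
qed

text \<open>The Markov property of the stationary chain is given through real conditional expectations; the
version for extended nonnegative functions is the one that can be integrated freely.\<close>

lemma nn_integral_markov_indicator:
  assumes F: "F \<in> borel_measurable (past S n)" and A [measurable]: "A \<in> sets S"
  shows "(\<integral>\<^sup>+\<omega>. F \<omega> * indicator A (\<omega> (n + 1)) \<partial>P) = (\<integral>\<^sup>+\<omega>. F \<omega> * emeasure (Q (\<omega> n)) A \<partial>P)"
proof -
  interpret past: finite_measure_subalgebra P "past S n"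
    by unfold_locales (rule subalgebra_past[OF sets_P])
  let ?I = "\<lambda>\<omega>. indicator A (\<omega> (n + 1)) :: real"
  have [measurable]: "?I \<in> borel_measurable P" "(\<lambda>\<omega>. ennreal (?I \<omega>)) \<in> borel_measurable P"
    by measurable
  have neg: "AE \<omega> in P. nn_cond_exp P (past S n) (\<lambda>\<omega>. ennreal (- ?I \<omega>)) \<omega> = 0"
  proof -
    have "(\<lambda>\<omega>. ennreal (- ?I \<omega>)) = (\<lambda>_. 0)" by (auto simp: ennreal_neg)
    then show ?thesis
      using past.nn_cond_exp_F_meas[of "\<lambda>_. 0"] by (auto elim!: eventually_mono)
  qed
  have one: "AE \<omega> in P. nn_cond_exp P (past S n) (\<lambda>_. 1) \<omega> = 1"
    using past.nn_cond_exp_F_meas[of "\<lambda>_. 1"] by (auto elim!: eventually_mono)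
  have mono: "AE \<omega> in P. nn_cond_exp P (past S n) (\<lambda>\<omega>. ennreal (?I \<omega>)) \<omega> \<le> nn_cond_exp P (past S n) (\<lambda>_. 1) \<omega>"
    by (rule past.nn_cond_exp_mono) (auto simp: indicator_def)
  have ae: "AE \<omega> in P. nn_cond_exp P (past S n) (\<lambda>\<omega>. ennreal (?I \<omega>)) \<omega> = emeasure (Q (\<omega> n)) A"
    using markov[OF A, of n] neg one mono AE_space
  proof eventually_elim
    case (elim \<omega>)
    then have "\<omega> n \<in> space S" by (auto simp: space_P space_PiM)
    then interpret Q: prob_space "Q (\<omega> n)" by (rule prob_space_Q)
    have "nn_cond_exp P (past S n) (\<lambda>\<omega>. ennreal (?I \<omega>)) \<omega> < \<top>"
      using elim(3,4) by (simp add: le_less_trans[of _ 1])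
    moreover have "enn2real (nn_cond_exp P (past S n) (\<lambda>\<omega>. ennreal (?I \<omega>)) \<omega>) = measure (Q (\<omega> n)) A"
      using elim(1,2) by (simp add: real_cond_exp_def)
    ultimately show ?case
      by (metis Q.emeasure_eq_measure ennreal_enn2real)
  qed
  have "(\<integral>\<^sup>+\<omega>. F \<omega> * indicator A (\<omega> (n + 1)) \<partial>P) = (\<integral>\<^sup>+\<omega>. F \<omega> * ennreal (?I \<omega>) \<partial>P)"
    by (intro nn_integral_cong) (simp add: indicator_def)
  also have "\<dots> = (\<integral>\<^sup>+\<omega>. F \<omega> * nn_cond_exp P (past S n) (\<lambda>\<omega>. ennreal (?I \<omega>)) \<omega> \<partial>P)"
    by (rule past.nn_cond_exp_intg[symmetric]) (simp_all add: F)
  also have "\<dots> = (\<integral>\<^sup>+\<omega>. F \<omega> * emeasure (Q (\<omega> n)) A \<partial>P)"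
    by (rule nn_integral_cong_AE) (use ae in eventually_elim, simp)
  finally show ?thesis .
qed

text \<open>Both sides are integrals of \<open>g\<close>, with respect to the law of the next state and to the law obtained by
applying \<open>Q\<close>, under the measure with density \<open>F\<close>; these two laws agree on sets.\<close>

lemma nn_integral_markov:
  assumes F: "F \<in> borel_measurable (past S n)" and g [measurable]: "g \<in> borel_measurable S"
  shows "(\<integral>\<^sup>+\<omega>. F \<omega> * g (\<omega> (n + 1)) \<partial>P) = (\<integral>\<^sup>+\<omega>. F \<omega> * (\<integral>\<^sup>+y. g y \<partial>Q (\<omega> n)) \<partial>P)"
proof -
  have F_P [measurable]: "F \<in> borel_measurable P"
    by (rule measurable_from_subalg[OF subalgebra_past[OF sets_P] F])
  have ker [measurable]: "(\<lambda>\<omega>. Q (\<omega> n)) \<in> measurable P (subprob_algebra S)"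
    by (rule measurable_compose[OF measurable_coordinate Q_subprob])
  then have ker': "(\<lambda>\<omega>. Q (\<omega> n)) \<in> measurable (density P F) (subprob_algebra S)"
    by (simp cong: measurable_cong_sets)
  have ne: "space (density P F) \<noteq> {}" using not_empty by simp
  have "distr (density P F) S (\<lambda>\<omega>. \<omega> (n + 1)) = density P F \<bind> (\<lambda>\<omega>. Q (\<omega> n))"
  proof (rule measure_eqI)
    show "sets (distr (density P F) S (\<lambda>\<omega>. \<omega> (n + 1))) = sets (density P F \<bind> (\<lambda>\<omega>. Q (\<omega> n)))"
    proof -
      have "sets (density P F \<bind> (\<lambda>\<omega>. Q (\<omega> n))) = sets S"
        by (rule sets_bind[OF _ ne]) (rule sets_kernel[OF ker'])
      then show ?thesis by simp
    qed
    fix A assume "A \<in> sets (distr (density P F) S (\<lambda>\<omega>. \<omega> (n + 1)))"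
    then have A [measurable]: "A \<in> sets S" by simp
    have "emeasure (distr (density P F) S (\<lambda>\<omega>. \<omega> (n + 1))) A =
        (\<integral>\<^sup>+z. indicator A z \<partial>distr (density P F) S (\<lambda>\<omega>. \<omega> (n + 1)))" by simp
    also have "\<dots> = (\<integral>\<^sup>+\<omega>. indicator A (\<omega> (n + 1)) \<partial>density P F)"
      by (rule nn_integral_distr) simp_all
    also have "\<dots> = (\<integral>\<^sup>+\<omega>. F \<omega> * indicator A (\<omega> (n + 1)) \<partial>P)"
      by (rule nn_integral_density) measurable
    also have "\<dots> = (\<integral>\<^sup>+\<omega>. F \<omega> * emeasure (Q (\<omega> n)) A \<partial>P)"
      by (rule nn_integral_markov_indicator[OF F A])
    also have "\<dots> = (\<integral>\<^sup>+\<omega>. emeasure (Q (\<omega> n)) A \<partial>density P F)"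
      by (rule nn_integral_density[symmetric]) measurable
    also have "\<dots> = emeasure (density P F \<bind> (\<lambda>\<omega>. Q (\<omega> n))) A"
      by (rule emeasure_bind[OF ne ker' A, symmetric])
    finally show "emeasure (distr (density P F) S (\<lambda>\<omega>. \<omega> (n + 1))) A =
      emeasure (density P F \<bind> (\<lambda>\<omega>. Q (\<omega> n))) A" .
  qed
  note eq = this
  have "(\<integral>\<^sup>+\<omega>. F \<omega> * g (\<omega> (n + 1)) \<partial>P) = (\<integral>\<^sup>+\<omega>. g (\<omega> (n + 1)) \<partial>density P F)"
    by (rule nn_integral_density[symmetric]) measurable
  also have "\<dots> = (\<integral>\<^sup>+z. g z \<partial>distr (density P F) S (\<lambda>\<omega>. \<omega> (n + 1)))"
    by (rule nn_integral_distr[symmetric]) simp_all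
  also have "\<dots> = (\<integral>\<^sup>+\<omega>. (\<integral>\<^sup>+y. g y \<partial>Q (\<omega> n)) \<partial>density P F)"
    unfolding eq by (rule nn_integral_bind[OF g ker'])
  also have "\<dots> = (\<integral>\<^sup>+\<omega>. F \<omega> * (\<integral>\<^sup>+y. g y \<partial>Q (\<omega> n)) \<partial>P)"
    by (rule nn_integral_density) measurable
  finally show ?thesis .
qed

text \<open>Measurability in the starting point and the mixture formula are proved together, by induction on the
number of factors: the last factor is absorbed into the one before it, in the same way for the chain started
at a point and for the stationary chain. The functions must therefore be arbitrary, not just indicators.\<close>

lemma chain_law_prod:
  fixes g :: "nat \<Rightarrow> 'a \<Rightarrow> ennreal"
  assumes "\<And>j. g j \<in> borel_measurable S"
  shows "(\<lambda>x. \<integral>\<^sup>+\<omega>. (\<Prod>j\<le>n. g j (\<omega> j)) \<partial>chain_law S Q x) \<in> borel_measurable S \<and>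
    (\<integral>\<^sup>+x. (\<integral>\<^sup>+\<omega>. (\<Prod>j\<le>n. g j (\<omega> j)) \<partial>chain_law S Q x) \<partial>\<pi>) = (\<integral>\<^sup>+\<omega>. (\<Prod>j\<le>n. g j (\<omega> (int j))) \<partial>P)"
  using assms
proof (induction n arbitrary: g)
  case 0
  note [measurable] = 0
  have eq: "(\<integral>\<^sup>+\<omega>. g 0 (\<omega> 0) \<partial>chain_law S Q x) = g 0 x" if x: "x \<in> space S" for x
  proof -
    have "(\<integral>\<^sup>+\<omega>. g 0 (\<omega> 0) \<partial>chain_law S Q x) = (\<integral>\<^sup>+z. g 0 z \<partial>distr (chain_law S Q x) S (\<lambda>\<omega>. \<omega> 0))"
      by (rule nn_integral_distr[symmetric]) (simp_all add: measurable_chain_law x)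
    then show ?thesis unfolding distr_chain_law_0[OF x] using x by (simp add: nn_integral_return)
  qed
  have "(\<integral>\<^sup>+x. (\<integral>\<^sup>+\<omega>. g 0 (\<omega> 0) \<partial>chain_law S Q x) \<partial>\<pi>) = (\<integral>\<^sup>+x. g 0 x \<partial>\<pi>)"
    by (rule nn_integral_cong) (simp add: eq)
  also have "\<dots> = (\<integral>\<^sup>+\<omega>. g 0 (\<omega> 0) \<partial>P)"
    unfolding marginal by (rule nn_integral_distr) simp_all
  finally show ?case
    by (simp add: measurable_cong[OF eq])
next
  case (Suc n)
  note [measurable] = Suc.prems
  define g' where "g' = fun_upd g n (\<lambda>x. g n x * (\<integral>\<^sup>+y. g (Suc n) y \<partial>Q x))"
  have g' [measurable]: "g' j \<in> borel_measurable S" for j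
    unfolding g'_def by (cases "j = n") auto
  have split: "(\<Prod>j\<le>n. g j (\<omega> j)) * (\<integral>\<^sup>+y. g (Suc n) y \<partial>Q (\<omega> n)) = (\<Prod>j\<le>n. g' j (\<omega> j))" for \<omega>
  proof -
    have "{..n} = insert n {..<n}" by auto
    then show ?thesis by (simp add: g'_def mult_ac)
  qed
  have step: "(\<integral>\<^sup>+\<omega>. (\<Prod>j\<le>Suc n. g j (\<omega> j)) \<partial>chain_law S Q x) = (\<integral>\<^sup>+\<omega>. (\<Prod>j\<le>n. g' j (\<omega> j)) \<partial>chain_law S Q x)"
    if "x \<in> space S" for x
    using nn_integral_chain_law_prod_Suc[of g x n] that Suc.prems by (simp only: split)
  note IH = Suc.IH[of g', OF g']
  have "(\<integral>\<^sup>+x. (\<integral>\<^sup>+\<omega>. (\<Prod>j\<le>Suc n. g j (\<omega> j)) \<partial>chain_law S Q x) \<partial>\<pi>) =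
      (\<integral>\<^sup>+x. (\<integral>\<^sup>+\<omega>. (\<Prod>j\<le>n. g' j (\<omega> j)) \<partial>chain_law S Q x) \<partial>\<pi>)"
    by (rule nn_integral_cong) (simp only: step space_pi)
  also have "\<dots> = (\<integral>\<^sup>+\<omega>. (\<Prod>j\<le>n. g' j (\<omega> (int j))) \<partial>P)"
    using IH by blast
  also have "\<dots> = (\<integral>\<^sup>+\<omega>. (\<Prod>j\<le>n. g j (\<omega> (int j))) * (\<integral>\<^sup>+y. g (Suc n) y \<partial>Q (\<omega> (int n))) \<partial>P)"
    by (rule nn_integral_cong) (rule split[of "\<lambda>j. _ (int j)", symmetric])
  also have "\<dots> = (\<integral>\<^sup>+\<omega>. (\<Prod>j\<le>n. g j (\<omega> (int j))) * g (Suc n) (\<omega> (int n + 1)) \<partial>P)"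
  proof (rule nn_integral_markov[symmetric])
    show "(\<lambda>\<omega>. \<Prod>j\<le>n. g j (\<omega> (int j))) \<in> borel_measurable (past S (int n))"
      by (rule borel_measurable_prod_ennreal, rule measurable_compose[OF measurable_past_coordinate Suc.prems]) auto
  qed measurable
  also have "\<dots> = (\<integral>\<^sup>+\<omega>. (\<Prod>j\<le>Suc n. g j (\<omega> (int j))) \<partial>P)"
    by (rule nn_integral_cong) (simp add: add.commute mult.commute)
  finally have "(\<integral>\<^sup>+x. (\<integral>\<^sup>+\<omega>. (\<Prod>j\<le>Suc n. g j (\<omega> j)) \<partial>chain_law S Q x) \<partial>\<pi>) =
    (\<integral>\<^sup>+\<omega>. (\<Prod>j\<le>Suc n. g j (\<omega> (int j))) \<partial>P)" .
  moreover have "(\<lambda>x. \<integral>\<^sup>+\<omega>. (\<Prod>j\<le>Suc n. g j (\<omega> j)) \<partial>chain_law S Q x) \<in> borel_measurable S"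
    using IH by (subst measurable_cong[OF step]) blast+
  ultimately show ?case by blast
qed

lemma cylinder_indicator:
  assumes n: "J \<subseteq> {..n}" and \<omega>: "\<omega> \<in> space paths"
  shows "indicator (prod_emb UNIV (\<lambda>_. S) J (Pi\<^sub>E J A)) \<omega> =
    (\<Prod>j\<le>n. (if j \<in> J then indicator (A j) else (\<lambda>_. 1)) (\<omega> j) :: ennreal)"
    (is "_ = (\<Prod>j\<le>n. ?g j (\<omega> j))")
proof (cases "\<forall>j\<in>J. \<omega> j \<in> A j")
  case True
  then have "\<omega> \<in> prod_emb UNIV (\<lambda>_. S) J (Pi\<^sub>E J A)"
    using \<omega> by (auto simp: prod_emb_def space_PiM)
  moreover have "(\<Prod>j\<le>n. ?g j (\<omega> j)) = 1"
    using True by (intro prod.neutral) auto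
  ultimately show ?thesis by simp
next
  case False
  then obtain j where j: "j \<in> J" "\<omega> j \<notin> A j" by blast
  then have "\<omega> \<notin> prod_emb UNIV (\<lambda>_. S) J (Pi\<^sub>E J A)"
    by (auto simp: prod_emb_def dest!: PiE_mem[of _ J A j])
  moreover have "(\<Prod>j\<le>n. ?g j (\<omega> j)) = 0"
    using j n by (intro prod_zero bexI[of _ j]) auto
  ultimately show ?thesis by simp
qed

lemma cylinder_sets:
  "finite J \<Longrightarrow> (\<And>j. j \<in> J \<Longrightarrow> A j \<in> sets S) \<Longrightarrow> prod_emb UNIV (\<lambda>_. S) J (Pi\<^sub>E J A) \<in> sets paths"
  by (rule sets_PiM_I) auto

lemma measurable_chain_law_kernel: "chain_law S Q \<in> measurable S (prob_algebra paths)"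
proof (rule measurable_prob_algebra_generated[OF sets_PiM Int_stable_prod_algebra prod_algebra_sets_into_space])
  fix A assume "A \<in> prod_algebra UNIV (\<lambda>_::nat. S)"
  then obtain J E where A: "A = prod_emb UNIV (\<lambda>_. S) J (Pi\<^sub>E J E)"
    and J: "finite J" "J \<noteq> {} \<or> UNIV = {}" "J \<subseteq> UNIV" and E: "\<And>j. j \<in> J \<Longrightarrow> E j \<in> sets S"
    by (rule prod_algebraE) blast
  \<comment> \<open>The indicator of a cylinder, written as a product with a factor \<open>1\<close> for every free coordinate.\<close>
  obtain n where n: "J \<subseteq> {..n}" using J finite_nat_iff_bounded_le by metis
  define g :: "nat \<Rightarrow> 'a \<Rightarrow> ennreal" where "g = (\<lambda>j. if j \<in> J then indicator (E j) else (\<lambda>_. 1))"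
  have g: "g j \<in> borel_measurable S" for j
    unfolding g_def using E by simp
  have ind: "indicator A \<omega> = (\<Prod>j\<le>n. g j (\<omega> j))" if "\<omega> \<in> space paths" for \<omega>
    using cylinder_indicator[OF n that] by (simp add: A g_def)
  have "A \<in> sets paths" unfolding A using J(1) E by (rule cylinder_sets)
  then have "emeasure (chain_law S Q x) A = (\<integral>\<^sup>+\<omega>. (\<Prod>j\<le>n. g j (\<omega> j)) \<partial>chain_law S Q x)"
    if "x \<in> space S" for x
    using that by (subst nn_integral_indicator[symmetric])
      (auto intro!: nn_integral_cong simp: ind sets_chain_law space_chain_law simp del: nn_integral_indicator)
  then show "(\<lambda>x. emeasure (chain_law S Q x) A) \<in> borel_measurable S"
    by (subst measurable_cong) (use chain_law_prod[of g n, OF g] in auto)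
qed (auto simp: prob_space_chain_law sets_chain_law)

lemma measurable_chain_law_subprob: "chain_law S Q \<in> measurable \<pi> (subprob_algebra paths)"
  unfolding measurable_pi by (rule measurable_prob_algebraD[OF measurable_chain_law_kernel])

lemma measurable_forward [measurable]: "(\<lambda>\<omega> k. \<omega> (int k)) \<in> measurable P paths"
proof (rule measurable_PiM_single')
  show "(\<lambda>\<omega> k. \<omega> (int k)) \<in> space P \<rightarrow> (\<Pi>\<^sub>E i\<in>UNIV. space S)"
    by (auto simp: space_P space_PiM)
qed measurable

text \<open>Cylinder sets determine the law, and their indicators are products over the path.\<close>

theorem distr_forward: "distr P paths (\<lambda>\<omega> k. \<omega> (int k)) = \<pi> \<bind> chain_law S Q"
proof (rule measure_eqI_PiM_infinite)
  have ne: "space \<pi> \<noteq> {}" using prob_space.not_empty[OF prob_space_pi] .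
  show "sets (\<pi> \<bind> chain_law S Q) = sets paths"
    by (rule sets_bind[OF _ ne]) (simp add: sets_chain_law)
  show "finite_measure (distr P paths (\<lambda>\<omega> k. \<omega> (int k)))"
    by (intro prob_space.finite_measure prob_space_distr) measurable
  fix A and J :: "nat set" assume J: "finite J" and E: "\<And>j. j \<in> J \<Longrightarrow> A j \<in> sets S"
  let ?A = "prod_emb UNIV (\<lambda>_. S) J (Pi\<^sub>E J A)"
  obtain n where n: "J \<subseteq> {..n}" using J finite_nat_iff_bounded_le by metis
  define g :: "nat \<Rightarrow> 'a \<Rightarrow> ennreal" where "g = (\<lambda>j. if j \<in> J then indicator (A j) else (\<lambda>_. 1))"
  have g: "g j \<in> borel_measurable S" for j
    unfolding g_def using E by simp
  have ind: "indicator ?A \<omega> = (\<Prod>j\<le>n. g j (\<omega> j))" if "\<omega> \<in> space paths" for \<omega>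
    using cylinder_indicator[OF n that] by (simp add: g_def)
  have A [measurable]: "?A \<in> sets paths" using J E by (rule cylinder_sets)
  have "emeasure (distr P paths (\<lambda>\<omega> k. \<omega> (int k))) ?A = (\<integral>\<^sup>+\<omega>. indicator ?A (\<lambda>k. \<omega> (int k)) \<partial>P)"
    by (subst nn_integral_distr[symmetric, where M'=paths]) simp_all
  also have "\<dots> = (\<integral>\<^sup>+\<omega>. (\<Prod>j\<le>n. g j (\<omega> (int j))) \<partial>P)"
    using measurable_space[OF measurable_forward] by (intro nn_integral_cong) (simp add: ind)
  also have "\<dots> = (\<integral>\<^sup>+x. (\<integral>\<^sup>+\<omega>. (\<Prod>j\<le>n. g j (\<omega> j)) \<partial>chain_law S Q x) \<partial>\<pi>)"
    using chain_law_prod[of g n, OF g] by simp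
  also have "\<dots> = (\<integral>\<^sup>+x. emeasure (chain_law S Q x) ?A \<partial>\<pi>)"
  proof (rule nn_integral_cong)
    fix x assume "x \<in> space \<pi>"
    then show "(\<integral>\<^sup>+\<omega>. (\<Prod>j\<le>n. g j (\<omega> j)) \<partial>chain_law S Q x) = emeasure (chain_law S Q x) ?A"
      by (subst nn_integral_indicator[symmetric])
       (auto intro!: nn_integral_cong simp: ind sets_chain_law space_chain_law simp del: nn_integral_indicator)
  qed
  also have "\<dots> = emeasure (\<pi> \<bind> chain_law S Q) ?A"
    by (rule emeasure_bind[OF ne measurable_chain_law_subprob A, symmetric])
  finally show "emeasure (distr P paths (\<lambda>\<omega> k. \<omega> (int k))) ?A = emeasure (\<pi> \<bind> chain_law S Q) ?A" .
qed simp

text \<open>This turns almost sure statements about the stationary chain into quenched ones.\<close>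

lemma AE_chain_law:
  assumes [measurable]: "Measurable.pred paths A" and "AE \<omega> in P. A (\<lambda>k. \<omega> (int k))"
  shows "AE x in \<pi>. AE \<omega> in chain_law S Q x. A \<omega>"
proof -
  have "AE \<omega> in distr P paths (\<lambda>\<omega> k. \<omega> (int k)). A \<omega>"
    using assms by (subst AE_distr_iff) simp_all
  then show ?thesis
    unfolding distr_forward by (subst (asm) AE_bind[OF measurable_chain_law_subprob]) simp_all
qed

lemma measurable_shift: "shift \<in> measurable P P"
proof -
  have "shift \<in> measurable P (PiM UNIV (\<lambda>_. S))"
    unfolding shift_def[abs_def]
  proof (rule measurable_PiM_single')
    show "(\<lambda>\<omega> n. \<omega> (n + 1)) \<in> space P \<rightarrow> (\<Pi>\<^sub>E i\<in>UNIV. space S)"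
      by (auto simp: space_P space_PiM)
  qed measurable
  then show ?thesis by (simp cong: measurable_cong_sets add: sets_P)
qed

sublocale shift: ergodic_map P shift
proof unfold_locales
  show "shift \<in> measurable P P" by (rule measurable_shift)
  show "distr P P shift = P" by (rule stationary)
  show "prob A = 0 \<or> prob A = 1" if "A \<in> sets P" "shift -` A \<inter> space P = A" for A
    using that by (rule ergodic)
qed

lemma funpow_shift: "(shift ^^ i) \<omega> = (\<lambda>n. \<omega> (n + int i))"
  by (induction i) (auto simp: shift_def add_ac)

lemma distr_coordinate: "distr P S (\<lambda>\<omega>. \<omega> (int j)) = \<pi>"
proof (induction j)
  case 0
  then show ?case by (simp add: marginal)
next
  case (Suc j)
  have "distr P S (\<lambda>\<omega>. \<omega> (int (Suc j))) = distr (distr P P shift) S (\<lambda>\<omega>. \<omega> (int j))"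
    by (subst distr_distr) (auto simp: measurable_shift comp_def shift_def add.commute)
  then show ?case by (simp add: stationary Suc)
qed

theorem chain_law_birkhoff:
  fixes k :: "'a \<Rightarrow> real"
  assumes k: "integrable \<pi> k"
  shows "AE x in \<pi>. AE \<omega> in chain_law S Q x. (\<lambda>n. (\<Sum>i<n. k (\<omega> i)) / real n) \<longlonglongrightarrow> (\<integral>y. k y \<partial>\<pi>)"
proof (rule AE_chain_law)
  have k_meas [measurable]: "k \<in> borel_measurable S"
    using borel_measurable_integrable[OF k] by (simp add: measurable_pi)
  show "Measurable.pred paths (\<lambda>\<omega>. (\<lambda>n. (\<Sum>i<n. k (\<omega> i)) / real n) \<longlonglongrightarrow> (\<integral>y. k y \<partial>\<pi>))"
    by measurable
  have "integrable P (\<lambda>\<omega>. k (\<omega> 0))"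
    using k unfolding marginal by (subst (asm) integrable_distr_eq) simp_all
  from shift.birkhoff_ergodic[OF this]
  show "AE \<omega> in P. (\<lambda>n. (\<Sum>i<n. k (\<omega> (int i))) / real n) \<longlonglongrightarrow> (\<integral>y. k y \<partial>\<pi>)"
    unfolding marginal by (subst integral_distr) (simp_all add: funpow_shift)
qed

lemma AE_chain_law_coordinates:
  assumes A: "AE y in \<pi>. A y"
  shows "AE x in \<pi>. AE \<omega> in chain_law S Q x. \<forall>j. A (\<omega> j)"
proof -
  from A obtain N where N: "N \<in> null_sets \<pi>" "{y \<in> space \<pi>. \<not> A y} \<subseteq> N"
    by (auto simp: eventually_ae_filter)
  then have [measurable]: "N \<in> sets S" by auto
  have "AE \<omega> in P. \<omega> (int j) \<notin> N" for j
  proof -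
    have "AE y in \<pi>. y \<notin> N" by (rule AE_not_in[OF N(1)])
    then show ?thesis unfolding distr_coordinate[of j, symmetric]
      by (subst (asm) AE_distr_iff) simp_all
  qed
  then have "AE \<omega> in P. \<forall>j. \<omega> (int j) \<notin> N" by (simp add: AE_all_countable)
  then have "AE x in \<pi>. AE \<omega> in chain_law S Q x. \<forall>j. \<omega> j \<notin> N"
    by (intro AE_chain_law) simp_all
  then show ?thesis
    using AE_space
  proof eventually_elim
    case (elim x)
    then have x: "x \<in> space S" by simp
    from elim(1) AE_space show ?case
      by eventually_elim (use N(2) in \<open>auto simp: space_chain_law x space_PiM\<close>)
  qed
qed

lemma nn_integral_pi_Q:
  assumes [measurable]: "g \<in> borel_measurable S"
  shows "(\<integral>\<^sup>+x. (\<integral>\<^sup>+y. g y \<partial>Q x) \<partial>\<pi>) = (\<integral>\<^sup>+x. g x \<partial>\<pi>)"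
proof -
  have "(\<integral>\<^sup>+x. (\<integral>\<^sup>+y. g y \<partial>Q x) \<partial>\<pi>) = (\<integral>\<^sup>+\<omega>. (\<integral>\<^sup>+y. g y \<partial>Q (\<omega> 0)) \<partial>P)"
    unfolding marginal by (rule nn_integral_distr) simp_all
  also have "\<dots> = (\<integral>\<^sup>+\<omega>. g (\<omega> 1) \<partial>P)"
    using nn_integral_markov[of "\<lambda>_. 1" 0 g] by simp
  also have "\<dots> = (\<integral>\<^sup>+x. g x \<partial>\<pi>)"
    unfolding distr_coordinate[of 1, symmetric] by (subst nn_integral_distr) simp_all
  finally show ?thesis .
qed

end

section \<open>Characteristic functions of a single step\<close>

lemma abs_exp_minus_linear_le:
  fixes a :: real
  assumes "0 \<le> a"
  shows "\<bar>exp (- a) - (1 - a)\<bar> \<le> min a (a\<^sup>2 / 2)"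
proof -
  have lower: "1 - a \<le> exp (- a)" using exp_ge_add_one_self[of "- a"] by simp
  have "exp (- a) \<le> 1 - a + a\<^sup>2 / 2"
  proof -
    have "1 \<le> (1 - a + a\<^sup>2 / 2) * (1 + a + a\<^sup>2 / 2)"
    proof -
      have "(1 - a + a\<^sup>2 / 2) * (1 + a + a\<^sup>2 / 2) = 1 + (a\<^sup>2)\<^sup>2 / 4"
        by (simp add: algebra_simps power2_eq_square)
      then show ?thesis by simp
    qed
    also have "\<dots> \<le> (1 - a + a\<^sup>2 / 2) * exp a"
    proof (rule mult_left_mono)
      show "1 + a + a\<^sup>2 / 2 \<le> exp a" by (rule exp_lower_Taylor_quadratic[OF assms])
      have eq: "1 - a + a\<^sup>2 / 2 = ((1 - a)\<^sup>2 + 1) / 2" by (simp add: power2_eq_square field_simps)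
      show "0 \<le> 1 - a + a\<^sup>2 / 2"
        by (subst eq) (intro divide_nonneg_nonneg add_nonneg_nonneg, auto)
    qed
    finally show ?thesis by (simp add: exp_minus field_simps)
  qed
  moreover have "exp (- a) \<le> 1" using assms by simp
  ultimately show ?thesis using lower by (simp add: min_def)
qed

text \<open>Second order Taylor expansion of the characteristic function of a centred variable and of the Gaussian with
the same variance. The error is \<open>s\<^sup>2\<close> times a quantity which depends on \<open>s\<close> only through the upper
bound \<open>\<delta>\<close>, is at most a multiple of the variance, and vanishes as \<open>\<delta> \<rightarrow> 0\<close>; so it can be averaged by the
ergodic theorem for each fixed \<open>\<delta>\<close>.\<close>

lemma (in prob_space) char_centered_gaussian_bound:
  fixes X :: "'a \<Rightarrow> real"
  assumes X [measurable]: "X \<in> borel_measurable M" and X2: "integrable M (\<lambda>z. (X z)\<^sup>2)"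
    and s: "\<bar>s\<bar> \<le> \<delta>"
  defines "d \<equiv> \<lambda>z. X z - expectation X"
  shows "cmod ((\<integral>z. iexp (s * d z) \<partial>M) - exp (- (s\<^sup>2 * expectation (\<lambda>z. (d z)\<^sup>2) / 2)))
    \<le> s\<^sup>2 * (expectation (\<lambda>z. min (6 * (d z)\<^sup>2) (\<delta> * \<bar>d z\<bar> ^ 3)) / 6 +
        min (expectation (\<lambda>z. (d z)\<^sup>2) / 2) (\<delta>\<^sup>2 * (expectation (\<lambda>z. (d z)\<^sup>2))\<^sup>2 / 8))"
proof -
  have X1: "integrable M X"
    by (rule square_integrable_imp_integrable[OF X X2])
  let ?v = "expectation (\<lambda>z. (d z)\<^sup>2)" and ?m = "expectation X"
  have d_meas [measurable]: "d \<in> borel_measurable M" unfolding d_def by measurable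
  have d1: "integrable M d" unfolding d_def using X1 by simp
  have "(\<lambda>z. (d z)\<^sup>2) = (\<lambda>z. (X z)\<^sup>2 - 2 * ?m * X z + ?m\<^sup>2)"
    by (auto simp: d_def power2_eq_square algebra_simps)
  then have d2: "integrable M (\<lambda>z. (d z)\<^sup>2)" using X1 X2 by simp
  have d0: "expectation d = 0" unfolding d_def using X1 by (simp add: prob_space)
  have v0: "0 \<le> ?v" by simp
  let ?e = "\<lambda>r. expectation (\<lambda>z. min (6 * (d z)\<^sup>2) (r * \<bar>d z\<bar> ^ 3))"
  have int: "integrable M (\<lambda>z. min (6 * (d z)\<^sup>2) (r * \<bar>d z\<bar> ^ 3))" if "0 \<le> r" for r
    by (rule Bochner_Integration.integrable_bound[where f="\<lambda>z. 6 * (d z)\<^sup>2"]) (use d2 that in auto)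
  have "?e \<bar>s\<bar> \<le> ?e \<delta>"
  proof (rule integral_mono)
    show "min (6 * (d z)\<^sup>2) (\<bar>s\<bar> * \<bar>d z\<bar> ^ 3) \<le> min (6 * (d z)\<^sup>2) (\<delta> * \<bar>d z\<bar> ^ 3)" for z
      by (intro min.mono mult_right_mono order_refl s) simp
  qed (use s in \<open>auto intro!: int\<close>)
  then have e_le: "s\<^sup>2 / 6 * ?e \<bar>s\<bar> \<le> s\<^sup>2 * (?e \<delta> / 6)"
    using mult_left_mono[of "?e \<bar>s\<bar>" "?e \<delta>" "s\<^sup>2 / 6"] by simp
  have char_eq: "char (distr M borel d) s = (\<integral>z. iexp (s * d z) \<partial>M)"
    unfolding char_def by (rule integral_distr) measurable
  have 1: "cmod ((\<integral>z. iexp (s * d z) \<partial>M) - (1 - s\<^sup>2 * ?v / 2)) \<le> s\<^sup>2 / 6 * ?e \<bar>s\<bar>"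
    using char_approx3'[of d ?v "distr M borel d" s] d1 d2 d0 by (simp add: char_eq)
  have "cmod (complex_of_real (1 - s\<^sup>2 * ?v / 2) - exp (- (s\<^sup>2 * ?v / 2))) = \<bar>exp (- (s\<^sup>2 * ?v / 2)) - (1 - s\<^sup>2 * ?v / 2)\<bar>"
    unfolding of_real_diff[symmetric] norm_of_real by (simp add: abs_minus_commute)
  also have "\<dots> \<le> min (s\<^sup>2 * ?v / 2) ((s\<^sup>2 * ?v / 2)\<^sup>2 / 2)"
    by (rule abs_exp_minus_linear_le) (use v0 in simp)
  also have "\<dots> \<le> s\<^sup>2 * min (?v / 2) (\<delta>\<^sup>2 * ?v\<^sup>2 / 8)"
  proof -
    have "s\<^sup>2 * s\<^sup>2 \<le> s\<^sup>2 * \<delta>\<^sup>2"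
      using s by (intro mult_left_mono) (auto simp: abs_le_square_iff[symmetric])
    then have "(s\<^sup>2 * s\<^sup>2) * (?v\<^sup>2 / 8) \<le> (s\<^sup>2 * \<delta>\<^sup>2) * (?v\<^sup>2 / 8)"
      by (rule mult_right_mono) simp
    moreover have "(s\<^sup>2 * ?v / 2)\<^sup>2 / 2 = (s\<^sup>2 * s\<^sup>2) * (?v\<^sup>2 / 8)"
      by (simp add: power2_eq_square field_simps)
    moreover have "s\<^sup>2 * min (?v / 2) (\<delta>\<^sup>2 * ?v\<^sup>2 / 8) = min (s\<^sup>2 * (?v / 2)) (s\<^sup>2 * (\<delta>\<^sup>2 * ?v\<^sup>2 / 8))"
      by (simp add: min_mult_distrib_left)
    ultimately show ?thesis by (simp add: min_def)
  qed
  finally have 2: "cmod (complex_of_real (1 - s\<^sup>2 * ?v / 2) - exp (- (s\<^sup>2 * ?v / 2))) \<le> s\<^sup>2 * min (?v / 2) (\<delta>\<^sup>2 * ?v\<^sup>2 / 8)" .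
  have "cmod ((\<integral>z. iexp (s * d z) \<partial>M) - exp (- (s\<^sup>2 * ?v / 2))) \<le>
      cmod ((\<integral>z. iexp (s * d z) \<partial>M) - (1 - s\<^sup>2 * ?v / 2)) + cmod (complex_of_real (1 - s\<^sup>2 * ?v / 2) - exp (- (s\<^sup>2 * ?v / 2)))"
    using norm_triangle_ineq[of "(\<integral>z. iexp (s * d z) \<partial>M) - complex_of_real (1 - s\<^sup>2 * ?v / 2)" "complex_of_real (1 - s\<^sup>2 * ?v / 2) - exp (- (s\<^sup>2 * ?v / 2))"]
    by simp
  also have "\<dots> \<le> s\<^sup>2 * (?e \<delta> / 6) + s\<^sup>2 * min (?v / 2) (\<delta>\<^sup>2 * ?v\<^sup>2 / 8)"
    using 1 2 e_le by linarith
  finally show ?thesis by (simp add: distrib_left)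
qed

definition step_var :: "('a \<Rightarrow> 'a measure) \<Rightarrow> ('a \<Rightarrow> real) \<Rightarrow> 'a \<Rightarrow> real" where
  "step_var Q \<theta> y = (\<integral>z. (\<theta> z - markov_op Q \<theta> y)\<^sup>2 \<partial>Q y)"

text \<open>The error factor of \<open>char_centered_gaussian_bound\<close> for one step of the chain from \<open>y\<close>. It plays the role
of the Lindeberg term.\<close>

definition step_error :: "('a \<Rightarrow> 'a measure) \<Rightarrow> ('a \<Rightarrow> real) \<Rightarrow> real \<Rightarrow> 'a \<Rightarrow> real" where
  "step_error Q \<theta> \<delta> y =
    (\<integral>z. min (6 * (\<theta> z - markov_op Q \<theta> y)\<^sup>2) (\<delta> * \<bar>\<theta> z - markov_op Q \<theta> y\<bar> ^ 3) \<partial>Q y) / 6 +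
    min (step_var Q \<theta> y / 2) (\<delta>\<^sup>2 * (step_var Q \<theta> y)\<^sup>2 / 8)"

lemma step_var_nonneg: "0 \<le> step_var Q \<theta> y"
  by (simp add: step_var_def)

lemma step_error_nonneg: "0 \<le> \<delta> \<Longrightarrow> 0 \<le> step_error Q \<theta> \<delta> y"
  unfolding step_error_def by (intro add_nonneg_nonneg) (auto simp: step_var_nonneg intro!: Bochner_Integration.integral_nonneg)

context markov_kernel
begin

lemma measurable_path_coordinate [measurable (raw)]:
  "g \<in> measurable S N \<Longrightarrow> (\<lambda>\<omega>. g (\<omega> (j::nat))) \<in> measurable paths N"
  by (rule measurable_compose[OF measurable_component_singleton]) auto

lemma measurable_integral_kernel:
  fixes g :: "'a \<Rightarrow> 'a \<Rightarrow> real"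
  assumes [measurable]: "(\<lambda>(y, z). g y z) \<in> borel_measurable (S \<Otimes>\<^sub>M S)"
  shows "(\<lambda>y. \<integral>z. g y z \<partial>Q y) \<in> borel_measurable S"
proof -
  have "(\<lambda>y. distr (Q y) (S \<Otimes>\<^sub>M S) (Pair y)) \<in> measurable S (subprob_algebra (S \<Otimes>\<^sub>M S))"
    by (rule measurable_distr2[OF _ Q_subprob]) simp
  from measurable_compose[OF this integral_measurable_subprob_algebra[OF assms]]
  have "(\<lambda>y. \<integral>p. (\<lambda>(y, z). g y z) p \<partial>distr (Q y) (S \<Otimes>\<^sub>M S) (Pair y)) \<in> borel_measurable S" .
  then show ?thesis
    by (rule measurable_cong[THEN iffD1, rotated]) (subst integral_distr, auto simp: measurable_Q)
qed

lemma measurable_markov_op [measurable]: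
  "f \<in> borel_measurable S \<Longrightarrow> markov_op Q f \<in> borel_measurable S"
  unfolding markov_op_def[abs_def]
  by (rule measurable_compose[OF Q_subprob integral_measurable_subprob_algebra])

lemma measurable_step_var [measurable]:
  assumes [measurable]: "\<theta> \<in> borel_measurable S"
  shows "step_var Q \<theta> \<in> borel_measurable S"
  unfolding step_var_def[abs_def]
  by (rule measurable_integral_kernel) measurable

lemma measurable_step_error [measurable]:
  assumes [measurable]: "\<theta> \<in> borel_measurable S"
  shows "step_error Q \<theta> \<delta> \<in> borel_measurable S"
proof -
  have [measurable]: "(\<lambda>y. \<integral>z. min (6 * (\<theta> z - markov_op Q \<theta> y)\<^sup>2) (\<delta> * \<bar>\<theta> z - markov_op Q \<theta> y\<bar> ^ 3) \<partial>Q y) \<in> borel_measurable S"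
    by (rule measurable_integral_kernel) measurable
  show ?thesis unfolding step_error_def[abs_def] by measurable
qed

lemma integrable_step_var:
  assumes \<theta> [measurable]: "\<theta> \<in> borel_measurable S" and y: "y \<in> space S" and \<theta>2: "integrable (Q y) (\<lambda>z. (\<theta> z)\<^sup>2)"
  shows "integrable (Q y) (\<lambda>z. (\<theta> z - markov_op Q \<theta> y)\<^sup>2)"
    "step_var Q \<theta> y = (\<integral>z. (\<theta> z)\<^sup>2 \<partial>Q y) - (markov_op Q \<theta> y)\<^sup>2"
proof -
  interpret Q: prob_space "Q y" by (rule prob_space_Q[OF y])
  have \<theta>1: "integrable (Q y) \<theta>"
    by (rule Q.square_integrable_imp_integrable) (simp_all add: measurable_Q y \<theta>2)
  have eq: "(\<lambda>z. (\<theta> z - markov_op Q \<theta> y)\<^sup>2) = (\<lambda>z. (\<theta> z)\<^sup>2 - 2 * markov_op Q \<theta> y * \<theta> z + (markov_op Q \<theta> y)\<^sup>2)"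
    by (auto simp: power2_eq_square algebra_simps)
  show "integrable (Q y) (\<lambda>z. (\<theta> z - markov_op Q \<theta> y)\<^sup>2)"
    unfolding eq using \<theta>1 \<theta>2 by simp
  show "step_var Q \<theta> y = (\<integral>z. (\<theta> z)\<^sup>2 \<partial>Q y) - (markov_op Q \<theta> y)\<^sup>2"
    unfolding step_var_def eq using \<theta>1 \<theta>2
    by (simp add: markov_op_def Q.prob_space power2_eq_square)
qed

lemma step_error_le:
  assumes \<theta> [measurable]: "\<theta> \<in> borel_measurable S" and y: "y \<in> space S" and \<theta>2: "integrable (Q y) (\<lambda>z. (\<theta> z)\<^sup>2)"
    and \<delta>: "0 \<le> \<delta>"
  shows "step_error Q \<theta> \<delta> y \<le> 2 * step_var Q \<theta> y"
proof -
  have "(\<integral>z. min (6 * (\<theta> z - markov_op Q \<theta> y)\<^sup>2) (\<delta> * \<bar>\<theta> z - markov_op Q \<theta> y\<bar> ^ 3) \<partial>Q y) \<le> (\<integral>z. 6 * (\<theta> z - markov_op Q \<theta> y)\<^sup>2 \<partial>Q y)"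
    by (rule Bochner_Integration.integral_mono') (use integrable_step_var[OF \<theta> y \<theta>2] in auto)
  also have "\<dots> = 6 * step_var Q \<theta> y" by (simp add: step_var_def)
  finally show ?thesis using step_var_nonneg[of Q \<theta> y] unfolding step_error_def by (simp add: min_def)
qed

lemma step_char_bound:
  assumes \<theta> [measurable]: "\<theta> \<in> borel_measurable S" and y: "y \<in> space S" and \<theta>2: "integrable (Q y) (\<lambda>z. (\<theta> z)\<^sup>2)"
    and s: "\<bar>s\<bar> \<le> \<delta>"
  shows "cmod (iexp (- (s * markov_op Q \<theta> y)) * (\<integral>z. iexp (s * \<theta> z) \<partial>Q y) - exp (- (s\<^sup>2 * step_var Q \<theta> y / 2)))
    \<le> s\<^sup>2 * step_error Q \<theta> \<delta> y"
proof -
  interpret Q: prob_space "Q y" by (rule prob_space_Q[OF y])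
  have "iexp (- (s * markov_op Q \<theta> y)) * (\<integral>z. iexp (s * \<theta> z) \<partial>Q y) =
      (\<integral>z. iexp (- (s * markov_op Q \<theta> y)) * iexp (s * \<theta> z) \<partial>Q y)" by simp
  also have "\<dots> = (\<integral>z. iexp (s * (\<theta> z - markov_op Q \<theta> y)) \<partial>Q y)"
    by (rule Bochner_Integration.integral_cong) (auto simp: exp_add[symmetric] algebra_simps)
  finally have eq: "iexp (- (s * markov_op Q \<theta> y)) * (\<integral>z. iexp (s * \<theta> z) \<partial>Q y) =
    (\<integral>z. iexp (s * (\<theta> z - markov_op Q \<theta> y)) \<partial>Q y)" .
  have "cmod ((\<integral>z. iexp (s * (\<theta> z - markov_op Q \<theta> y)) \<partial>Q y) - exp (- (s\<^sup>2 * step_var Q \<theta> y / 2)))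
    \<le> s\<^sup>2 * step_error Q \<theta> \<delta> y"
    unfolding step_error_def step_var_def markov_op_def
    by (rule Q.char_centered_gaussian_bound) (simp_all add: measurable_Q y \<theta>2 s)
  then show ?thesis unfolding eq .
qed

end

section \<open>A central limit theorem for martingales along a Markov path\<close>

text \<open>The increments \<open>\<theta> (\<xi>\<^sub>j\<^sub>+\<^sub>1) - Q \<theta> (\<xi>\<^sub>j)\<close> are martingale differences whose conditional laws
depend on \<open>\<xi>\<^sub>j\<close> only. Convergence of the averages of the conditional variances and of the errors along the path
is an assumption, because for a chain started at a point it comes from the stationary chain.\<close>

locale markov_clt = markov_kernel S Q
  for S :: "'a measure" and Q +
  fixes M :: "(nat \<Rightarrow> 'a) measure" and \<theta> :: "'a \<Rightarrow> real" and s :: real and e :: "nat \<Rightarrow> real"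
  assumes law: "markov_law S Q M"
    and theta [measurable]: "\<theta> \<in> borel_measurable S"
    and s_nonneg: "0 \<le> s"
    and square_integrable: "AE \<omega> in M. \<forall>j. integrable (Q (\<omega> j)) (\<lambda>z. (\<theta> z)\<^sup>2)"
    and var_average: "AE \<omega> in M. (\<lambda>n. (\<Sum>j<n. step_var Q \<theta> (\<omega> j)) / real n) \<longlonglongrightarrow> s"
    and error_average: "\<And>N. AE \<omega> in M. (\<lambda>n. (\<Sum>j<n. step_error Q \<theta> (1 / Suc N) (\<omega> j)) / real n) \<longlonglongrightarrow> e N"
    and error_vanishes: "e \<longlonglongrightarrow> 0"
begin

abbreviation m :: "'a \<Rightarrow> real" where "m \<equiv> markov_op Q \<theta>"
abbreviation v :: "'a \<Rightarrow> real" where "v \<equiv> step_var Q \<theta>"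

sublocale prob_space M by (rule prob_space_markov_law[OF law])

lemma borel_M: "borel_measurable M = borel_measurable paths"
  by (rule measurable_markov_law[OF law])

definition increment :: "nat \<Rightarrow> (nat \<Rightarrow> 'a) \<Rightarrow> real" where
  "increment j \<omega> = \<theta> (\<omega> (Suc j)) - m (\<omega> j)"

text \<open>The sum of the conditional variances, including that of step \<open>j\<close>, is known before step \<open>j\<close> is made. Stopping
when its \<open>n\<close>-th part would exceed \<open>s + 1\<close> is thus compatible with the martingale structure; it keeps all exponentials below
bounded, and almost surely it does not happen for large \<open>n\<close>.\<close>

definition within_budget :: "nat \<Rightarrow> nat \<Rightarrow> (nat \<Rightarrow> 'a) \<Rightarrow> bool" where
  "within_budget n j \<omega> \<longleftrightarrow> (\<Sum>i\<le>j. v (\<omega> i)) / n \<le> s + 1"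

text \<open>Each factor has conditional expectation approximately \<open>1\<close>, since multiplication by \<open>exp (u\<^sup>2 v / 2)\<close>, with
\<open>u = t / \<surd>n\<close>, compensates the Gaussian approximation \<open>exp (- u\<^sup>2 v / 2)\<close> of the conditional characteristic
function.\<close>

definition stopped_exp :: "real \<Rightarrow> nat \<Rightarrow> nat \<Rightarrow> (nat \<Rightarrow> 'a) \<Rightarrow> complex" where
  "stopped_exp t n k \<omega> = (\<Prod>j<k. if within_budget n j \<omega>
     then iexp (t / sqrt n * increment j \<omega>) * exp (t\<^sup>2 * v (\<omega> j) / (2 * n)) else 1)"

definition exp_bound :: "real \<Rightarrow> real" where
  "exp_bound t = exp (t\<^sup>2 * (s + 1) / 2)"

lemma increment_measurable [measurable]: "increment j \<in> borel_measurable paths"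
  unfolding increment_def[abs_def] by measurable

lemma within_budget_measurable [measurable]: "Measurable.pred paths (within_budget n j)"
  unfolding within_budget_def[abs_def] by measurable

lemma stopped_exp_measurable [measurable]: "stopped_exp t n k \<in> borel_measurable paths"
  unfolding stopped_exp_def[abs_def] by measurable

lemma stopped_variance_le:
  "(\<Sum>j<k. if within_budget n j \<omega> then v (\<omega> j) / n else 0) \<le> s + 1"
proof -
  have le: "(\<Sum>j<k. if within_budget n j \<omega> then v (\<omega> j) / n else 0) \<le> (\<Sum>j<k. v (\<omega> j)) / n" for k
    unfolding sum_divide_distrib by (rule sum_mono) (simp add: step_var_nonneg)
  show ?thesis
  proof (induction k)
    case 0
    show ?case using s_nonneg by simp
  next
    case (Suc k)
    show ?case
    proof (cases "within_budget n k \<omega>")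
      case True
      then show ?thesis
        using le[of "Suc k"] by (simp only: within_budget_def lessThan_Suc_atMost)
    next
      case False
      then show ?thesis using Suc by simp
    qed
  qed
qed

lemma norm_stopped_exp_le: "norm (stopped_exp t n k \<omega>) \<le> exp_bound t"
proof -
  have "norm (stopped_exp t n k \<omega>) = (\<Prod>j<k. if within_budget n j \<omega> then exp (t\<^sup>2 * v (\<omega> j) / (2 * n)) else 1)"
    unfolding stopped_exp_def prod_norm[symmetric] by (rule prod.cong) (auto simp: norm_mult)
  also have "\<dots> = exp (\<Sum>j<k. if within_budget n j \<omega> then t\<^sup>2 * v (\<omega> j) / (2 * n) else 0)"
    by (subst exp_sum) (auto intro!: prod.cong)
  also have "(\<Sum>j<k. if within_budget n j \<omega> then t\<^sup>2 * v (\<omega> j) / (2 * n) else 0) =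
      t\<^sup>2 / 2 * (\<Sum>j<k. if within_budget n j \<omega> then v (\<omega> j) / n else 0)"
    unfolding sum_distrib_left by (rule sum.cong) auto
  also have "exp \<dots> \<le> exp_bound t"
    unfolding exp_bound_def
    using mult_left_mono[OF stopped_variance_le[of n \<omega> k], of "t\<^sup>2 / 2"] by simp
  finally show ?thesis .
qed

text \<open>Before stopping, the next value of \<open>stopped_exp\<close> is this function of the past times a function of the next
state.\<close>

definition weight :: "real \<Rightarrow> nat \<Rightarrow> nat \<Rightarrow> (nat \<Rightarrow> 'a) \<Rightarrow> complex" where
  "weight t n k \<omega> = (if within_budget n k \<omega>
     then stopped_exp t n k \<omega> * exp (t\<^sup>2 * v (\<omega> k) / (2 * n)) * iexp (- (t / sqrt n * m (\<omega> k))) else 0)"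

lemma weight_measurable [measurable]: "weight t n k \<in> borel_measurable paths"
  unfolding weight_def[abs_def] by measurable

lemma norm_weight_le: "norm (weight t n k \<omega>) \<le> exp_bound t"
proof (cases "within_budget n k \<omega>")
  case True
  then have "norm (weight t n k \<omega>) = norm (stopped_exp t n (Suc k) \<omega>)"
    by (simp add: weight_def stopped_exp_def norm_mult)
  then show ?thesis using norm_stopped_exp_le by simp
next
  case False
  then show ?thesis by (simp add: weight_def exp_bound_def)
qed

lemma stopped_exp_Suc: "stopped_exp t n (Suc k) \<omega> = weight t n k \<omega> * iexp (t / sqrt n * \<theta> (\<omega> (Suc k))) +
  (if within_budget n k \<omega> then 0 else stopped_exp t n k \<omega>)"
proof (cases "within_budget n k \<omega>")
  case True
  have "iexp (t / sqrt n * increment k \<omega>) = iexp (- (t / sqrt n * m (\<omega> k))) * iexp (t / sqrt n * \<theta> (\<omega> (Suc k)))"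
    unfolding exp_add[symmetric] increment_def by (simp add: algebra_simps)
  then show ?thesis using True by (simp add: weight_def stopped_exp_def)
qed (simp add: weight_def stopped_exp_def)

lemma weight_cong_past:
  assumes "\<And>i. i \<le> k \<Longrightarrow> \<omega> i = \<omega>' i"
  shows "weight t n k \<omega> = weight t n k \<omega>'"
proof -
  have a: "within_budget n j \<omega> = within_budget n j \<omega>'" if "j \<le> k" for j
    unfolding within_budget_def using assms that by simp
  have increment: "increment j \<omega> = increment j \<omega>'" if "j < k" for j
    unfolding increment_def using assms that by simp
  have "stopped_exp t n k \<omega> = stopped_exp t n k \<omega>'"
    unfolding stopped_exp_def by (rule prod.cong) (simp_all add: a increment assms)
  then show ?thesis unfolding weight_def by (simp add: a assms)
qed

lemma expectation_stopped_exp_Suc: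
  "expectation (stopped_exp t n (Suc k)) - expectation (stopped_exp t n k) =
    expectation (\<lambda>\<omega>. weight t n k \<omega> * (\<integral>y. iexp (t / sqrt n * \<theta> y) \<partial>Q (\<omega> k)) -
      (if within_budget n k \<omega> then stopped_exp t n k \<omega> else 0))"
  (is "_ = expectation (\<lambda>\<omega>. weight t n k \<omega> * ?\<phi> \<omega> - ?A \<omega>)")
proof -
  let ?g = "\<lambda>y. iexp (t / sqrt n * \<theta> y)" and ?w = "weight t n k"
  have [measurable]: "?\<phi> \<in> borel_measurable paths"
    by (rule measurable_compose[OF _ measurable_compose[OF Q_subprob integral_measurable_subprob_algebra]])
      measurable
  have phi: "norm (?\<phi> \<omega>) \<le> 1" if "\<omega> \<in> space M" for \<omega>
  proof -
    have "\<omega> k \<in> space S" using that by (auto simp: space_markov_law[OF law] space_PiM)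
    then interpret Q: prob_space "Q (\<omega> k)" by (rule prob_space_Q)
    have "norm (?\<phi> \<omega>) \<le> (\<integral>y. norm (?g y) \<partial>Q (\<omega> k))" by (rule integral_norm_bound)
    then show ?thesis by (simp add: Q.prob_space)
  qed
  have bnd: "norm (a * b) \<le> exp_bound t" if "norm a \<le> exp_bound t" "norm b \<le> 1" for a b :: complex
    using mult_mono[OF that] by (simp add: norm_mult exp_bound_def)
  have int_Z: "integrable M (stopped_exp t n j)" for j
    by (rule integrable_const_bound[where B="exp_bound t"]) (simp_all add: norm_stopped_exp_le borel_M)
  have int_A: "integrable M ?A"
    by (rule integrable_const_bound[where B="exp_bound t"])
      (use norm_stopped_exp_le in \<open>auto simp: borel_M exp_bound_def\<close>)
  have int_g: "integrable M (\<lambda>\<omega>. ?w \<omega> * ?g (\<omega> (Suc k)))"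
    by (rule integrable_const_bound[where B="exp_bound t"]) (simp_all add: bnd norm_weight_le borel_M)
  have int_phi: "integrable M (\<lambda>\<omega>. ?w \<omega> * ?\<phi> \<omega>)"
    by (rule integrable_const_bound[where B="exp_bound t"], rule AE_I2, rule bnd[OF norm_weight_le phi])
      (simp_all add: borel_M)
  have "stopped_exp t n (Suc k) = (\<lambda>\<omega>. ?w \<omega> * ?g (\<omega> (Suc k)) + (stopped_exp t n k \<omega> - ?A \<omega>))"
    by (auto simp: stopped_exp_Suc fun_eq_iff)
  then have "expectation (stopped_exp t n (Suc k)) = expectation (\<lambda>\<omega>. ?w \<omega> * ?g (\<omega> (Suc k))) + (expectation (stopped_exp t n k) - expectation ?A)"
    using int_g int_Z int_A by simp
  also have "expectation (\<lambda>\<omega>. ?w \<omega> * ?g (\<omega> (Suc k))) = expectation (\<lambda>\<omega>. ?w \<omega> * ?\<phi> \<omega>)"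
    by (rule integral_markov_law[OF law, where B="exp_bound t"])
      (auto intro: weight_cong_past simp: norm_weight_le)
  finally show ?thesis using int_phi int_A by simp
qed

text \<open>The expectations of successive values differ by at most \<open>u\<^sup>2\<close> times the expected error of the step, by
\<open>step_char_bound\<close>. The errors before stopping are dominated by twice the variances, hence sum to at most
\<open>2 (s + 1)\<close> after division by \<open>n\<close>; this bound allows dominated convergence later on.\<close>

lemma expectation_stopped_exp_close:
  assumes n: "0 < n" and \<delta>: "\<bar>t\<bar> / sqrt n \<le> \<delta>"
  shows "norm (expectation (stopped_exp t n n) - 1) \<le>
    exp_bound t * t\<^sup>2 * expectation (\<lambda>\<omega>. min ((\<Sum>j<n. step_error Q \<theta> \<delta> (\<omega> j)) / n) (2 * (s + 1)))"
proof -
  let ?u = "t / sqrt n" and ?H = "step_error Q \<theta> \<delta>"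
  define R where "R k \<omega> = (if within_budget n k \<omega> then exp_bound t * (?u\<^sup>2 * ?H (\<omega> k)) else 0)" for k \<omega>
  have \<delta>0: "0 \<le> \<delta>" and u: "\<bar>?u\<bar> \<le> \<delta>" using \<delta> order_trans[OF _ \<delta>] by auto
  have u2: "?u\<^sup>2 = t\<^sup>2 / n" using n by (simp add: power_divide)
  have H0: "0 \<le> ?H y" for y by (rule step_error_nonneg[OF \<delta>0])
  have H_meas [measurable]: "?H \<in> borel_measurable S" by measurable
  have R_meas [measurable]: "R k \<in> borel_measurable paths" for k
    unfolding R_def[abs_def] by measurable
  have good: "AE \<omega> in M. \<forall>j. \<omega> j \<in> space S \<and> integrable (Q (\<omega> j)) (\<lambda>z. (\<theta> z)\<^sup>2)"
    using square_integrable AE_space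
    by eventually_elim (auto simp: space_markov_law[OF law] space_PiM)
  have sum_R: "AE \<omega> in M. (\<Sum>k<n. R k \<omega>) \<le> exp_bound t * t\<^sup>2 * min ((\<Sum>j<n. ?H (\<omega> j)) / n) (2 * (s + 1))"
    using good
  proof eventually_elim
    case (elim \<omega>)
    have "(\<Sum>k<n. R k \<omega>) = exp_bound t * t\<^sup>2 * (\<Sum>k<n. if within_budget n k \<omega> then ?H (\<omega> k) / n else 0)"
      unfolding sum_distrib_left by (rule sum.cong) (auto simp: R_def u2)
    moreover have "(\<Sum>k<n. if within_budget n k \<omega> then ?H (\<omega> k) / n else 0) \<le> (\<Sum>j<n. ?H (\<omega> j)) / n"
      unfolding sum_divide_distrib by (rule sum_mono) (simp add: H0)
    moreover have "(\<Sum>k<n. if within_budget n k \<omega> then ?H (\<omega> k) / n else 0) \<le> 2 * (\<Sum>k<n. if within_budget n k \<omega> then v (\<omega> k) / n else 0)"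
      unfolding sum_distrib_left
    proof (rule sum_mono)
      fix k
      have "?H (\<omega> k) \<le> 2 * v (\<omega> k)" using elim by (intro step_error_le \<delta>0) auto
      from divide_right_mono[OF this, of "real n"]
      show "(if within_budget n k \<omega> then ?H (\<omega> k) / n else 0) \<le> 2 * (if within_budget n k \<omega> then v (\<omega> k) / n else 0)"
        by simp
    qed
    ultimately show ?case
      using stopped_variance_le[of n \<omega> n] by (auto simp: exp_bound_def intro!: mult_left_mono)
  qed
  have R0: "0 \<le> R k \<omega>" for k \<omega> by (simp add: R_def H0 exp_bound_def)
  have R_bound: "AE \<omega> in M. norm (R k \<omega>) \<le> exp_bound t * t\<^sup>2 * (2 * (s + 1))" if "k < n" for k
    using sum_R
  proof eventually_elim
    case (elim \<omega>)
    have "R k \<omega> \<le> (\<Sum>k<n. R k \<omega>)" using that by (intro member_le_sum) (auto simp: R0)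
    also have "\<dots> \<le> exp_bound t * t\<^sup>2 * min ((\<Sum>j<n. ?H (\<omega> j)) / n) (2 * (s + 1))" by (rule elim)
    also have "\<dots> \<le> exp_bound t * t\<^sup>2 * (2 * (s + 1))"
      by (intro mult_left_mono min.cobounded2) (simp add: exp_bound_def)
    finally show ?case using R0 by simp
  qed
  have int_R: "integrable M (R k)" if "k < n" for k
    by (rule integrable_const_bound[OF R_bound[OF that]]) (simp add: borel_M)
  have step: "norm (expectation (stopped_exp t n (Suc k)) - expectation (stopped_exp t n k)) \<le> expectation (R k)" if "k < n" for k
    unfolding expectation_stopped_exp_Suc
  proof (rule order_trans[OF integral_norm_bound integral_mono_AE'])
    show "integrable M (R k)" by (rule int_R[OF that])
    show "AE \<omega> in M. 0 \<le> R k \<omega>" by (simp add: R0)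
    show "AE \<omega> in M. norm (weight t n k \<omega> * (\<integral>y. iexp (?u * \<theta> y) \<partial>Q (\<omega> k)) - (if within_budget n k \<omega> then stopped_exp t n k \<omega> else 0)) \<le> R k \<omega>"
      using good
    proof eventually_elim
      case (elim \<omega>)
      show ?case
      proof (cases "within_budget n k \<omega>")
        case False
        then show ?thesis by (simp add: weight_def R_def)
      next
        case True
        let ?a = "?u\<^sup>2 * v (\<omega> k) / 2"
        let ?\<phi> = "iexp (- (?u * m (\<omega> k))) * (\<integral>y. iexp (?u * \<theta> y) \<partial>Q (\<omega> k))"
        have a: "t\<^sup>2 * v (\<omega> k) / (2 * n) = ?a" by (simp add: u2)
        have *: "weight t n k \<omega> * (\<integral>y. iexp (?u * \<theta> y) \<partial>Q (\<omega> k)) - stopped_exp t n k \<omega> =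
            stopped_exp t n k \<omega> * exp ?a * (?\<phi> - exp (- ?a))"
          using True unfolding weight_def a
          by (simp add: algebra_simps exp_minus of_real_inverse[symmetric] del: of_real_inverse) (simp flip: of_real_mult)
        have "norm (stopped_exp t n k \<omega> * exp ?a) = norm (weight t n k \<omega>)"
          using True unfolding weight_def a by (simp add: norm_mult)
        then have "norm (stopped_exp t n k \<omega> * exp ?a) \<le> exp_bound t" using norm_weight_le by simp
        moreover have "norm (?\<phi> - exp (- ?a)) \<le> ?u\<^sup>2 * ?H (\<omega> k)"
          by (rule step_char_bound) (use elim u in auto)
        ultimately have "norm (stopped_exp t n k \<omega> * exp ?a * (?\<phi> - exp (- ?a))) \<le> exp_bound t * (?u\<^sup>2 * ?H (\<omega> k))"
          unfolding norm_mult[of "stopped_exp t n k \<omega> * exp ?a"] by (intro mult_mono) (auto simp: exp_bound_def)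
        then show ?thesis using True * by (simp add: R_def)
      qed
    qed
  qed
  have stopped_exp_0: "stopped_exp t n 0 = (\<lambda>_. 1)" by (simp add: stopped_exp_def fun_eq_iff)
  have "expectation (stopped_exp t n n) - 1 = (\<Sum>k<n. expectation (stopped_exp t n (Suc k)) - expectation (stopped_exp t n k))"
    by (subst sum_lessThan_telescope) (simp add: stopped_exp_0 prob_space)
  also have "norm \<dots> \<le> (\<Sum>k<n. expectation (R k))"
    by (rule order_trans[OF norm_sum]) (rule sum_mono, simp add: step)
  also have "\<dots> = expectation (\<lambda>\<omega>. \<Sum>k<n. R k \<omega>)"
    by (rule Bochner_Integration.integral_sum[symmetric]) (simp add: int_R)
  also have "\<dots> \<le> expectation (\<lambda>\<omega>. exp_bound t * t\<^sup>2 * min ((\<Sum>j<n. ?H (\<omega> j)) / n) (2 * (s + 1)))"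
  proof (rule integral_mono_AE[OF _ _ sum_R])
    show "integrable M (\<lambda>\<omega>. \<Sum>k<n. R k \<omega>)"
      by (rule Bochner_Integration.integrable_sum) (simp add: int_R)
    have "integrable M (\<lambda>\<omega>. min ((\<Sum>j<n. ?H (\<omega> j)) / n) (2 * (s + 1)))"
      by (rule integrable_const_bound[where B="2 * (s + 1)"])
        (use s_nonneg in \<open>auto simp: borel_M H0 sum_nonneg min_def\<close>)
    then show "integrable M (\<lambda>\<omega>. exp_bound t * t\<^sup>2 * min ((\<Sum>j<n. ?H (\<omega> j)) / n) (2 * (s + 1)))"
      by simp
  qed
  finally show ?thesis by simp
qed

text \<open>For fixed \<open>N\<close>, the limit over \<open>n\<close> of the bound above is at most a multiple of \<open>e N\<close>, with a factor that
does not depend on \<open>N\<close>.\<close>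

lemma expectation_stopped_exp_tendsto: "(\<lambda>n. expectation (stopped_exp t n n)) \<longlonglongrightarrow> 1"
proof (rule tendstoI)
  fix r :: real assume r: "0 < r"
  define K where "K = exp_bound t * t\<^sup>2"
  have K: "0 \<le> K" by (simp add: K_def exp_bound_def)
  define r' where "r' = r / (K + 1)"
  have r': "0 < r'" using r K by (simp add: r'_def)
  from order_tendstoD(2)[OF error_vanishes r'] obtain N where N: "e N < r'"
    by (auto simp: eventually_sequentially)
  let ?\<delta> = "1 / real (Suc N)"
  let ?Y = "\<lambda>(n::nat) \<omega>. min ((\<Sum>j<n. step_error Q \<theta> ?\<delta> (\<omega> j)) / real n) (2 * (s + 1))"
  have [measurable]: "step_error Q \<theta> ?\<delta> \<in> borel_measurable S" by measurable
  have "(\<lambda>n. expectation (?Y n)) \<longlonglongrightarrow> expectation (\<lambda>_. min (e N) (2 * (s + 1)))"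
  proof (rule integral_dominated_convergence[where w="\<lambda>_. 2 * (s + 1)"])
    show "AE \<omega> in M. (\<lambda>n. ?Y n \<omega>) \<longlonglongrightarrow> min (e N) (2 * (s + 1))"
      using error_average[of N] by eventually_elim (intro tendsto_min tendsto_const)
    show "AE \<omega> in M. norm (?Y n \<omega>) \<le> 2 * (s + 1)" for n
      using s_nonneg by (intro AE_I2) (auto simp: min_def sum_nonneg step_error_nonneg)
  qed (simp_all add: borel_M)
  then have "(\<lambda>n. expectation (?Y n)) \<longlonglongrightarrow> min (e N) (2 * (s + 1))" by (simp add: prob_space)
  then have "\<forall>\<^sub>F n in sequentially. expectation (?Y n) < r'"
    by (rule order_tendstoD) (use N in linarith)
  moreover have "(\<lambda>n. \<bar>t\<bar> / sqrt (real n)) \<longlonglongrightarrow> 0"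
    by (intro tendsto_divide_0[OF tendsto_const] filterlim_at_top_imp_at_infinity
        filterlim_compose[OF sqrt_at_top filterlim_real_sequentially])
  then have "\<forall>\<^sub>F n in sequentially. \<bar>t\<bar> / sqrt (real n) < ?\<delta>"
    by (rule order_tendstoD) simp
  ultimately show "\<forall>\<^sub>F n in sequentially. dist (expectation (stopped_exp t n n)) 1 < r"
    using eventually_gt_at_top[of 0]
  proof eventually_elim
    case (elim n)
    have "norm (expectation (stopped_exp t n n) - 1) \<le> K * expectation (?Y n)"
      unfolding K_def by (rule expectation_stopped_exp_close) (use elim in auto)
    also have "\<dots> \<le> K * r'" using elim K by (intro mult_left_mono) auto
    also have "\<dots> < r" using r K by (simp add: r'_def field_simps)
    finally show ?case by (simp add: dist_norm)
  qed
qed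

lemma stopped_exp_eq:
  assumes n: "0 < n" and W: "(\<Sum>j<n. v (\<omega> j)) / n \<le> s + 1"
  shows "stopped_exp t n n \<omega> = iexp (t / sqrt n * (\<Sum>j<n. increment j \<omega>)) * exp (t\<^sup>2 / 2 * ((\<Sum>j<n. v (\<omega> j)) / n))"
proof -
  have "within_budget n j \<omega>" if "j < n" for j
  proof -
    have "(\<Sum>i\<le>j. v (\<omega> i)) \<le> (\<Sum>i<n. v (\<omega> i))"
      using that by (intro sum_mono2) (auto simp: step_var_nonneg)
    from divide_right_mono[OF this, of "real n"] show ?thesis
      unfolding within_budget_def using W by simp
  qed
  then have "stopped_exp t n n \<omega> = (\<Prod>j<n. iexp (t / sqrt n * increment j \<omega>)) * of_real (\<Prod>j<n. exp (t\<^sup>2 * v (\<omega> j) / (2 * n)))"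
    unfolding stopped_exp_def of_real_prod prod.distrib[symmetric] by (intro prod.cong) auto
  also have "(\<Prod>j<n. iexp (t / sqrt n * increment j \<omega>)) = iexp (t / sqrt n * (\<Sum>j<n. increment j \<omega>))"
    by (simp add: exp_sum[symmetric] sum_distrib_left)
  also have "(\<Prod>j<n. exp (t\<^sup>2 * v (\<omega> j) / (2 * n))) = exp (\<Sum>j<n. t\<^sup>2 * v (\<omega> j) / (2 * n))"
    by (simp add: exp_sum)
  also have "(\<Sum>j<n. t\<^sup>2 * v (\<omega> j) / (2 * n)) = t\<^sup>2 / 2 * ((\<Sum>j<n. v (\<omega> j)) / n)"
    by (simp add: sum_divide_distrib[symmetric] sum_distrib_left[symmetric])
  finally show ?thesis .
qed

text \<open>As soon as the variance budget suffices up to time \<open>n\<close>, the stopped exponential is the exponential of the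
martingale times \<open>exp (t\<^sup>2 W / 2)\<close> for an average \<open>W\<close> tending to \<open>s\<close>.\<close>

theorem char_martingale_tendsto:
  "(\<lambda>n. expectation (\<lambda>\<omega>. iexp (t / sqrt n * (\<Sum>j<n. increment j \<omega>)))) \<longlonglongrightarrow> exp (- (t\<^sup>2 * s / 2))"
proof -
  let ?c = "complex_of_real (exp (- (t\<^sup>2 * s / 2)))"
  let ?X = "\<lambda>n \<omega>. iexp (t / sqrt (real n) * (\<Sum>j<n. increment j \<omega>))"
  have int_Z: "integrable M (stopped_exp t n n)" for n
    by (rule integrable_const_bound[where B="exp_bound t"]) (simp_all add: norm_stopped_exp_le borel_M)
  have int_X: "integrable M (?X n)" for n
    by (rule integrable_const_bound[where B=1]) (simp_all add: borel_M)
  have "(\<lambda>n. expectation (\<lambda>\<omega>. ?X n \<omega> - ?c * stopped_exp t n n \<omega>)) \<longlonglongrightarrow> expectation (\<lambda>_. 0)"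
  proof (rule integral_dominated_convergence[where w="\<lambda>_. 1 + exp_bound t"])
    show "AE \<omega> in M. (\<lambda>n. ?X n \<omega> - ?c * stopped_exp t n n \<omega>) \<longlonglongrightarrow> 0"
      using var_average
    proof eventually_elim
      case (elim \<omega>)
      let ?W = "\<lambda>n. (\<Sum>j<n. v (\<omega> j)) / real n"
      have "(\<lambda>n. exp (t\<^sup>2 / 2 * (?W n - s))) \<longlonglongrightarrow> exp (t\<^sup>2 / 2 * (s - s))"
        by (intro tendsto_exp tendsto_mult tendsto_const tendsto_diff elim)
      then have lim: "(\<lambda>n. 1 - exp (t\<^sup>2 / 2 * (?W n - s))) \<longlonglongrightarrow> 0"
        using tendsto_diff[OF tendsto_const[of 1]] by fastforce
      have "\<forall>\<^sub>F n in sequentially. ?W n < s + 1"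
        by (rule order_tendstoD(2)[OF elim]) simp
      then have "\<forall>\<^sub>F n in sequentially. norm (?X n \<omega> - ?c * stopped_exp t n n \<omega>) \<le> \<bar>1 - exp (t\<^sup>2 / 2 * (?W n - s))\<bar>"
        using eventually_gt_at_top[of 0]
      proof eventually_elim
        case (elim n)
        have exp_W: "exp (- (t\<^sup>2 * s / 2)) * exp (t\<^sup>2 / 2 * ?W n) = exp (t\<^sup>2 / 2 * (?W n - s))"
          unfolding exp_add[symmetric] by (simp add: algebra_simps)
        have mult: "a * z = x * c" if "a * b = c" "z = x * b" for a b c x z :: complex
          using that by (auto simp: mult_ac)
        from exp_W have "?c * of_real (exp (t\<^sup>2 / 2 * ?W n)) = complex_of_real (exp (t\<^sup>2 / 2 * (?W n - s)))"
          by (simp only: of_real_mult[symmetric])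
        moreover have "stopped_exp t n n \<omega> = ?X n \<omega> * of_real (exp (t\<^sup>2 / 2 * ?W n))"
          by (rule stopped_exp_eq) (use elim in auto)
        ultimately have "?c * stopped_exp t n n \<omega> = ?X n \<omega> * of_real (exp (t\<^sup>2 / 2 * (?W n - s)))"
          by (rule mult)
        then have "?X n \<omega> - ?c * stopped_exp t n n \<omega> = ?X n \<omega> * of_real (1 - exp (t\<^sup>2 / 2 * (?W n - s)))"
          by (simp add: algebra_simps)
        then show ?case by (simp only: norm_mult norm_exp_i_times norm_of_real) simp
      qed
      then show ?case
        by (rule Lim_null_comparison) (use tendsto_rabs_zero[OF lim] in simp)
    qed
    show "AE \<omega> in M. norm (?X n \<omega> - ?c * stopped_exp t n n \<omega>) \<le> 1 + exp_bound t" for n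
    proof (rule AE_I2)
      fix \<omega>
      have "exp (- (t\<^sup>2 * s / 2)) * norm (stopped_exp t n n \<omega>) \<le> 1 * exp_bound t"
        using s_nonneg by (intro mult_mono norm_stopped_exp_le) auto
      then have "norm (?c * stopped_exp t n n \<omega>) \<le> exp_bound t" by (simp add: norm_mult)
      moreover have "norm (?X n \<omega>) = 1" by (rule norm_exp_i_times)
      ultimately show "norm (?X n \<omega> - ?c * stopped_exp t n n \<omega>) \<le> 1 + exp_bound t"
        using norm_triangle_ineq4[of "?X n \<omega>" "?c * stopped_exp t n n \<omega>"] by linarith
    qed
  qed (simp_all add: borel_M)
  then have "(\<lambda>n. expectation (?X n) - ?c * expectation (stopped_exp t n n)) \<longlonglongrightarrow> 0"
    using int_X int_Z by simp
  from tendsto_add[OF this tendsto_mult[OF tendsto_const[of ?c] expectation_stopped_exp_tendsto[of t]]]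
  show ?thesis by simp
qed

end

section \<open>Gaussian limits through approximation in probability\<close>

lemma norm_iexp_diff_le: "cmod (iexp a - iexp b) \<le> \<bar>a - b\<bar>"
proof -
  have "iexp a - iexp b = iexp b * (iexp (a - b) - 1)"
    unfolding right_diff_distrib exp_add[symmetric] by (simp add: algebra_simps)
  then have "cmod (iexp a - iexp b) = cmod (iexp (a - b) - 1)"
    by (simp add: norm_mult)
  also have "\<dots> \<le> \<bar>a - b\<bar>"
    using iexp_approx1[of "a - b" 0] by simp
  finally show ?thesis .
qed

lemma norm_iexp_diff_le_2: "cmod (iexp a - iexp b) \<le> 2"
  using norm_triangle_ineq4[of "iexp a" "iexp b"] by simp

context prob_space
begin

lemma integrable_iexp: "X \<in> borel_measurable M \<Longrightarrow> integrable M (\<lambda>\<omega>. iexp (t * X \<omega> :: real))"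
  by (rule integrable_const_bound[where B=1]) auto

lemma char_tendsto_of_AE_close:
  fixes X Y :: "nat \<Rightarrow> 'a \<Rightarrow> real"
  assumes [measurable]: "\<And>n. X n \<in> borel_measurable M" "\<And>n. Y n \<in> borel_measurable M"
    and close: "AE \<omega> in M. (\<lambda>n. X n \<omega> - Y n \<omega>) \<longlonglongrightarrow> 0"
    and X: "(\<lambda>n. expectation (\<lambda>\<omega>. iexp (t * X n \<omega>))) \<longlonglongrightarrow> l"
  shows "(\<lambda>n. expectation (\<lambda>\<omega>. iexp (t * Y n \<omega>))) \<longlonglongrightarrow> l"
proof -
  have diff: "expectation (\<lambda>\<omega>. iexp (t * X n \<omega>) - iexp (t * Y n \<omega>)) =
      expectation (\<lambda>\<omega>. iexp (t * X n \<omega>)) - expectation (\<lambda>\<omega>. iexp (t * Y n \<omega>))" for n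
    by (rule Bochner_Integration.integral_diff) (rule integrable_iexp, measurable)+
  have "(\<lambda>n. expectation (\<lambda>\<omega>. iexp (t * X n \<omega>) - iexp (t * Y n \<omega>))) \<longlonglongrightarrow> expectation (\<lambda>_. 0)"
  proof (rule integral_dominated_convergence[where w="\<lambda>_. 2"])
    show "AE \<omega> in M. (\<lambda>n. iexp (t * X n \<omega>) - iexp (t * Y n \<omega>)) \<longlonglongrightarrow> 0"
      using close
    proof eventually_elim
      case (elim \<omega>)
      have "(\<lambda>n. \<bar>t * (X n \<omega> - Y n \<omega>)\<bar>) \<longlonglongrightarrow> 0"
        using tendsto_rabs[OF tendsto_mult[OF tendsto_const[of t] elim]] by simp
      then show ?case
      proof (rule Lim_null_comparison[rotated], intro always_eventually allI)
        show "cmod (iexp (t * X n \<omega>) - iexp (t * Y n \<omega>)) \<le> \<bar>t * (X n \<omega> - Y n \<omega>)\<bar>" for n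
          unfolding right_diff_distrib by (rule norm_iexp_diff_le)
      qed
    qed
    show "AE \<omega> in M. norm (iexp (t * X n \<omega>) - iexp (t * Y n \<omega>)) \<le> 2" for n
      by (intro AE_I2 norm_iexp_diff_le_2)
  qed simp_all
  then have "(\<lambda>n. expectation (\<lambda>\<omega>. iexp (t * X n \<omega>)) - expectation (\<lambda>\<omega>. iexp (t * Y n \<omega>))) \<longlonglongrightarrow> 0"
    by (simp only: diff Bochner_Integration.integral_zero)
  from tendsto_diff[OF X this] show ?thesis by simp
qed

lemma char_diff_le_prob:
  fixes X Y :: "'a \<Rightarrow> real"
  assumes [measurable]: "X \<in> borel_measurable M" "Y \<in> borel_measurable M" and "0 \<le> \<epsilon>"
  shows "cmod (expectation (\<lambda>\<omega>. iexp (t * X \<omega>)) - expectation (\<lambda>\<omega>. iexp (t * Y \<omega>)))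
    \<le> \<bar>t\<bar> * \<epsilon> + 2 * prob {\<omega>\<in>space M. \<epsilon> < \<bar>X \<omega> - Y \<omega>\<bar>}"
proof -
  let ?A = "{\<omega>\<in>space M. \<epsilon> < \<bar>X \<omega> - Y \<omega>\<bar>}"
  have A [measurable]: "?A \<in> sets M" by measurable
  have "expectation (\<lambda>\<omega>. iexp (t * X \<omega>)) - expectation (\<lambda>\<omega>. iexp (t * Y \<omega>)) =
      expectation (\<lambda>\<omega>. iexp (t * X \<omega>) - iexp (t * Y \<omega>))"
    by (rule Bochner_Integration.integral_diff[symmetric]) (rule integrable_iexp, measurable)+
  also have "cmod \<dots> \<le> expectation (\<lambda>\<omega>. cmod (iexp (t * X \<omega>) - iexp (t * Y \<omega>)))"
    by (rule integral_norm_bound)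
  also have "\<dots> \<le> expectation (\<lambda>\<omega>. \<bar>t\<bar> * \<epsilon> + 2 * indicator ?A \<omega>)"
  proof (rule integral_mono)
    show "integrable M (\<lambda>\<omega>. cmod (iexp (t * X \<omega>) - iexp (t * Y \<omega>)))"
      by (intro integrable_norm Bochner_Integration.integrable_diff integrable_iexp) measurable
    show "integrable M (\<lambda>\<omega>. \<bar>t\<bar> * \<epsilon> + 2 * indicator ?A \<omega>)"
      by (simp add: emeasure_eq_measure)
    fix \<omega> assume \<omega>: "\<omega> \<in> space M"
    show "cmod (iexp (t * X \<omega>) - iexp (t * Y \<omega>)) \<le> \<bar>t\<bar> * \<epsilon> + 2 * indicator ?A \<omega>"
    proof (cases "\<omega> \<in> ?A")
      case True
      then show ?thesis using norm_iexp_diff_le_2[of "t * X \<omega>" "t * Y \<omega>"] \<open>0 \<le> \<epsilon>\<close>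
        by (simp add: add_increasing)
    next
      case False
      then have "\<bar>X \<omega> - Y \<omega>\<bar> \<le> \<epsilon>" using \<omega> by auto
      from mult_left_mono[OF this, of "\<bar>t\<bar>"] norm_iexp_diff_le[of "t * X \<omega>" "t * Y \<omega>"] False
      show ?thesis by (simp add: abs_mult[symmetric] right_diff_distrib)
    qed
  qed
  also have "\<dots> = \<bar>t\<bar> * \<epsilon> + 2 * prob ?A"
    by (simp add: prob_space emeasure_eq_measure)
  finally show ?thesis .
qed

text \<open>The closeness threshold for \<open>m\<close> does not depend on \<open>t\<close>. This is what permits to choose \<open>m0\<close> first and then a
point \<open>t0\<close> so small that the Gaussian with variance \<open>s m0\<close> has a characteristic function near \<open>1\<close> there. For
large \<open>m\<close> the values at \<open>t0\<close> then stay above \<open>1/4\<close>, and taking logarithms shows that \<open>s\<close> converges.\<close>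

theorem gaussian_char_of_approximation:
  fixes Y :: "nat \<Rightarrow> 'a \<Rightarrow> real" and Z :: "nat \<Rightarrow> nat \<Rightarrow> 'a \<Rightarrow> real" and s :: "nat \<Rightarrow> real"
  assumes Y [measurable]: "\<And>n. Y n \<in> borel_measurable M"
    and Z [measurable]: "\<And>m n. Z m n \<in> borel_measurable M"
    and s: "\<And>m. 0 \<le> s m"
    and char_Z: "\<And>m t. (\<lambda>n. expectation (\<lambda>\<omega>. iexp (t * Z m n \<omega>))) \<longlonglongrightarrow> complex_of_real (exp (- (t\<^sup>2 * s m / 2)))"
    and close: "\<And>k::nat. (\<lambda>m. limsup (\<lambda>n. emeasure M {\<omega>\<in>space M. \<bar>Y n \<omega> - Z m n \<omega>\<bar> > 1 / Suc k})) \<longlonglongrightarrow> 0"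
  shows "\<exists>L\<ge>0. s \<longlonglongrightarrow> L \<and> (\<forall>t. (\<lambda>n. expectation (\<lambda>\<omega>. iexp (t * Y n \<omega>))) \<longlonglongrightarrow> complex_of_real (exp (- (t\<^sup>2 * L / 2))))"
proof -
  define \<phi> where "\<phi> t n = expectation (\<lambda>\<omega>. iexp (t * Y n \<omega>))" for t n
  define a where "a t m = exp (- (t\<^sup>2 * s m / 2))" for t m
  have char_near: "\<forall>\<^sub>F m in sequentially. \<forall>t. \<forall>\<^sub>F n in sequentially. cmod (\<phi> t n - a t m) < \<bar>t\<bar> / Suc k + r"
    if r: "0 < r" for r and k :: nat
  proof -
    from close[of k] have "\<forall>\<^sub>F m in sequentially. limsup (\<lambda>n. emeasure M {\<omega>\<in>space M. \<bar>Y n \<omega> - Z m n \<omega>\<bar> > 1 / Suc k}) < ennreal (r / 4)"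
      by (rule order_tendstoD) (use r in simp)
    then show ?thesis
    proof (rule eventually_mono, intro allI)
      fix m t
      assume elim: "limsup (\<lambda>n. emeasure M {\<omega>\<in>space M. \<bar>Y n \<omega> - Z m n \<omega>\<bar> > 1 / Suc k}) < ennreal (r / 4)"
      have "\<forall>\<^sub>F n in sequentially. emeasure M {\<omega>\<in>space M. \<bar>Y n \<omega> - Z m n \<omega>\<bar> > 1 / Suc k} < ennreal (r / 4)"
        by (rule Limsup_lessD[OF elim])
      moreover have "\<forall>\<^sub>F n in sequentially. dist (expectation (\<lambda>\<omega>. iexp (t * Z m n \<omega>))) (a t m) < r / 2"
        unfolding a_def by (rule tendstoD[OF char_Z]) (use r in simp)
      ultimately show "\<forall>\<^sub>F n in sequentially. cmod (\<phi> t n - a t m) < \<bar>t\<bar> / Suc k + r"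
      proof eventually_elim
        case (elim n)
        have p: "prob {\<omega>\<in>space M. \<bar>Y n \<omega> - Z m n \<omega>\<bar> > 1 / Suc k} < r / 4"
          using elim(1) r by (simp add: emeasure_eq_measure ennreal_less_iff)
        have "cmod (\<phi> t n - expectation (\<lambda>\<omega>. iexp (t * Z m n \<omega>))) \<le>
            \<bar>t\<bar> * (1 / Suc k) + 2 * prob {\<omega>\<in>space M. \<bar>Y n \<omega> - Z m n \<omega>\<bar> > 1 / Suc k}"
          unfolding \<phi>_def by (rule char_diff_le_prob) auto
        then have "cmod (\<phi> t n - expectation (\<lambda>\<omega>. iexp (t * Z m n \<omega>))) < \<bar>t\<bar> / Suc k + r / 2"
          using p by simp
        moreover have "cmod (expectation (\<lambda>\<omega>. iexp (t * Z m n \<omega>)) - a t m) < r / 2"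
          using elim(2) by (simp add: dist_norm)
        ultimately show ?case
          using norm_triangle_ineq[of "\<phi> t n - expectation (\<lambda>\<omega>. iexp (t * Z m n \<omega>))" "expectation (\<lambda>\<omega>. iexp (t * Z m n \<omega>)) - a t m"]
          by simp
      qed
    qed
  qed
  have char_near': "\<forall>\<^sub>F m in sequentially. \<forall>\<^sub>F n in sequentially. cmod (\<phi> t n - a t m) < r" if r: "0 < r" for t r
  proof -
    have "(\<lambda>k. \<bar>t\<bar> / real (Suc k)) \<longlonglongrightarrow> 0"
      by (rule LIMSEQ_Suc[OF lim_const_over_n])
    then have "\<forall>\<^sub>F k in sequentially. \<bar>t\<bar> / real (Suc k) < r / 2"
      by (rule order_tendstoD) (use r in simp)
    then obtain k where k: "\<bar>t\<bar> / real (Suc k) < r / 2" by (auto simp: eventually_sequentially)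
    have "0 < r / 2" using r by simp
    from char_near[OF this, of k] show ?thesis
    proof (rule eventually_mono)
      fix m assume "\<forall>t. \<forall>\<^sub>F n in sequentially. cmod (\<phi> t n - a t m) < \<bar>t\<bar> / Suc k + r / 2"
      then have "\<forall>\<^sub>F n in sequentially. cmod (\<phi> t n - a t m) < \<bar>t\<bar> / Suc k + r / 2" by (rule spec)
      then show "\<forall>\<^sub>F n in sequentially. cmod (\<phi> t n - a t m) < r"
        by (rule eventually_mono) (use k in linarith)
    qed
  qed
  have near: "\<bar>a t m - a t m'\<bar> < p + q"
    if "\<forall>\<^sub>F n in sequentially. cmod (\<phi> t n - a t m) < p" "\<forall>\<^sub>F n in sequentially. cmod (\<phi> t n - a t m') < q" for t m m' p q
  proof -
    from eventually_conj[OF that] obtain n where n: "cmod (\<phi> t n - a t m) < p" "cmod (\<phi> t n - a t m') < q"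
      by (auto simp: eventually_sequentially)
    have "cmod (complex_of_real (a t m) - complex_of_real (a t m')) \<le> cmod (\<phi> t n - a t m) + cmod (\<phi> t n - a t m')"
      using norm_triangle_ineq4[of "\<phi> t n - a t m'" "\<phi> t n - a t m"] by simp
    then show ?thesis using n unfolding of_real_diff[symmetric] norm_of_real by linarith
  qed
  have Cauchy_a: "Cauchy (a t)" for t
  proof (rule metric_CauchyI)
    fix r :: real assume r: "0 < r"
    then have "0 < r / 2" by simp
    from eventually_sequentially[THEN iffD1, OF char_near'[OF this, of t]]
    obtain K where K: "\<And>m. m \<ge> K \<Longrightarrow> \<forall>\<^sub>F n in sequentially. cmod (\<phi> t n - a t m) < r / 2"
      by blast
    have "dist (a t m) (a t m') < r" if "m \<ge> K" "m' \<ge> K" for m m'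
      using near[OF K[OF that(1)] K[OF that(2)]] by (simp add: dist_real_def)
    then show "\<exists>K. \<forall>m\<ge>K. \<forall>n\<ge>K. dist (a t m) (a t n) < r" by blast
  qed
  have "(0::real) < 1 / 4" by simp
  from eventually_sequentially[THEN iffD1, OF char_near[OF this, of 0]]
  obtain m0 where m0: "\<And>t. \<forall>\<^sub>F n in sequentially. cmod (\<phi> t n - a t m0) < \<bar>t\<bar> + 1 / 4"
    by auto
  \<comment> \<open>The first bound makes the error \<open>\<bar>t0\<bar> + 1/4\<close> at most \<open>1/2\<close>; the second, together with the first, makes
    \<open>t0\<^sup>2 * s m0 / 2\<close> at most \<open>1/8\<close>.\<close>
  define t0 where "t0 = min (1 / 4) (1 / (s m0 + 1))"
  have t0: "0 < t0" "t0 \<le> 1 / 4" "t0 \<le> 1 / (s m0 + 1)"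
    using s[of m0] by (auto simp: t0_def)
  have "t0 * s m0 \<le> 1 / (s m0 + 1) * s m0" using t0 s by (intro mult_right_mono) auto
  also have "\<dots> \<le> 1" using s[of m0] by (simp add: field_simps)
  finally have "t0 * (t0 * s m0) \<le> 1 / 4 * 1" using t0 s[of m0] by (intro mult_mono) auto
  then have "7 / 8 \<le> 1 - t0\<^sup>2 * s m0 / 2" by (simp add: power2_eq_square)
  also have "\<dots> \<le> a t0 m0" unfolding a_def using exp_ge_add_one_self[of "- (t0\<^sup>2 * s m0 / 2)"] by simp
  finally have a0: "7 / 8 \<le> a t0 m0" .
  obtain \<alpha> where \<alpha>: "a t0 \<longlonglongrightarrow> \<alpha>"
    using Cauchy_a[of t0] Cauchy_convergent_iff convergent_def by blast
  have "\<forall>\<^sub>F m in sequentially. 1 / 4 \<le> a t0 m"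
  proof -
    have "(0::real) < 1 / 8" by simp
    from char_near'[OF this, of t0] show ?thesis
    proof (rule eventually_mono)
      fix m assume "\<forall>\<^sub>F n in sequentially. cmod (\<phi> t0 n - a t0 m) < 1 / 8"
      from near[OF this m0[of t0]] show "1 / 4 \<le> a t0 m" using t0 a0 by linarith
    qed
  qed
  then have "1 / 4 \<le> \<alpha>"
    by (rule tendsto_lowerbound[OF \<alpha>]) simp
  then have \<alpha>0: "\<alpha> \<noteq> 0" by linarith
  define L where "L = - 2 / t0\<^sup>2 * ln \<alpha>"
  have s_eq: "s m = - 2 / t0\<^sup>2 * ln (a t0 m)" for m
    using t0 by (simp add: a_def)
  have s_L: "s \<longlonglongrightarrow> L"
    unfolding s_eq[abs_def] L_def by (intro tendsto_mult tendsto_const tendsto_ln \<alpha> \<alpha>0)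
  have L0: "0 \<le> L" by (rule LIMSEQ_le_const[OF s_L]) (use s in auto)
  have "(\<phi> t) \<longlonglongrightarrow> complex_of_real (exp (- (t\<^sup>2 * L / 2)))" for t
  proof (rule tendstoI)
    fix r :: real assume "0 < r"
    then have r: "0 < r / 2" by simp
    have "a t \<longlonglongrightarrow> exp (- (t\<^sup>2 * L / 2))"
      unfolding a_def by (intro tendsto_intros s_L) simp
    from eventually_happens'[OF sequentially_bot eventually_conj[OF char_near'[OF r, of t] tendstoD[OF this r]]]
    obtain m where m: "\<forall>\<^sub>F n in sequentially. cmod (\<phi> t n - a t m) < r / 2" "dist (a t m) (exp (- (t\<^sup>2 * L / 2))) < r / 2"
      by blast
    from m(2) have *: "cmod (complex_of_real (a t m) - exp (- (t\<^sup>2 * L / 2))) < r / 2"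
      unfolding dist_real_def of_real_diff[symmetric] norm_of_real .
    from m(1) show "\<forall>\<^sub>F n in sequentially. dist (\<phi> t n) (exp (- (t\<^sup>2 * L / 2))) < r"
    proof (rule eventually_mono)
      fix n assume "cmod (\<phi> t n - a t m) < r / 2"
      with * norm_triangle_ineq[of "\<phi> t n - a t m" "complex_of_real (a t m) - exp (- (t\<^sup>2 * L / 2))"]
      show "dist (\<phi> t n) (exp (- (t\<^sup>2 * L / 2))) < r" by (simp add: dist_norm)
    qed
  qed
  then show ?thesis using L0 s_L unfolding \<phi>_def by blast
qed

end

section \<open>The quenched central limit theorem for martingales\<close>

context stationary_ergodic_markov_chain
begin

sublocale pi: prob_space \<pi> by (rule prob_space_pi)

text \<open>This rests on the invariance of \<open>\<pi>\<close> under \<open>Q\<close>. Where \<open>h\<close> is not integrable, the Bochner integral is \<open>0\<close>, which does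
not spoil the upper bound on the integral of \<open>markov_op Q h\<close>.\<close>

lemma integrable_Q_of_integrable_pi:
  fixes h :: "'a \<Rightarrow> real"
  assumes h [measurable]: "h \<in> borel_measurable S" and nonneg: "\<And>y. 0 \<le> h y" and int: "integrable \<pi> h"
  shows "AE y in \<pi>. integrable (Q y) h" "integrable \<pi> (markov_op Q h)"
proof -
  have "(\<integral>\<^sup>+y. (\<integral>\<^sup>+z. ennreal (h z) \<partial>Q y) \<partial>\<pi>) = (\<integral>\<^sup>+y. ennreal (h y) \<partial>\<pi>)"
    by (rule nn_integral_pi_Q) measurable
  also have "\<dots> < \<infinity>" using int nonneg by (simp add: integrable_iff_bounded)
  finally have fin: "(\<integral>\<^sup>+y. (\<integral>\<^sup>+z. ennreal (h z) \<partial>Q y) \<partial>\<pi>) < \<infinity>" .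
  have meas: "(\<lambda>y. \<integral>\<^sup>+z. ennreal (h z) \<partial>Q y) \<in> borel_measurable \<pi>"
    unfolding measurable_pi by measurable
  have "AE y in \<pi>. (\<integral>\<^sup>+z. ennreal (h z) \<partial>Q y) \<noteq> \<infinity>"
    by (rule nn_integral_PInf_AE[OF meas]) (use fin in simp)
  then show "AE y in \<pi>. integrable (Q y) h"
    using AE_space
  proof eventually_elim
    case (elim y)
    then show ?case
      by (intro integrableI_nonneg) (auto simp: nonneg measurable_Q less_top[symmetric])
  qed
  show "integrable \<pi> (markov_op Q h)"
  proof (rule integrableI_bounded)
    show "markov_op Q h \<in> borel_measurable \<pi>" unfolding measurable_pi by measurable
    have "(\<integral>\<^sup>+y. ennreal (norm (markov_op Q h y)) \<partial>\<pi>) \<le> (\<integral>\<^sup>+y. (\<integral>\<^sup>+z. ennreal (h z) \<partial>Q y) \<partial>\<pi>)"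
    proof (rule nn_integral_mono)
      fix y assume "y \<in> space \<pi>"
      show "ennreal (norm (markov_op Q h y)) \<le> (\<integral>\<^sup>+z. ennreal (h z) \<partial>Q y)"
      proof (cases "integrable (Q y) h")
        case True
        then show ?thesis
          unfolding markov_op_def by (subst nn_integral_eq_integral) (simp_all add: nonneg)
      next
        case False
        then show ?thesis by (simp add: markov_op_def not_integrable_integral_eq)
      qed
    qed
    then show "(\<integral>\<^sup>+y. ennreal (norm (markov_op Q h y)) \<partial>\<pi>) < \<infinity>"
      using fin by (rule le_less_trans)
  qed
qed

definition sq_int :: "('a \<Rightarrow> real) \<Rightarrow> bool" where
  "sq_int g \<longleftrightarrow> g \<in> borel_measurable S \<and> integrable \<pi> (\<lambda>x. (g x)\<^sup>2)"

lemma sq_int_Q: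
  assumes "sq_int g"
  shows "AE y in \<pi>. integrable (Q y) (\<lambda>z. (g z)\<^sup>2)" "integrable \<pi> (\<lambda>y. \<integral>z. (g z)\<^sup>2 \<partial>Q y)"
    "AE y in \<pi>. integrable (Q y) g"
proof -
  have g [measurable]: "g \<in> borel_measurable S" and g2: "integrable \<pi> (\<lambda>x. (g x)\<^sup>2)"
    using assms by (auto simp: sq_int_def)
  have "(\<lambda>x. (g x)\<^sup>2) \<in> borel_measurable S" by measurable
  note * = integrable_Q_of_integrable_pi[OF this zero_le_power2 g2]
  show "AE y in \<pi>. integrable (Q y) (\<lambda>z. (g z)\<^sup>2)" by (rule *(1))
  show "integrable \<pi> (\<lambda>y. \<integral>z. (g z)\<^sup>2 \<partial>Q y)"
    using *(2) by (simp add: markov_op_def[abs_def])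
  from *(1) AE_space show "AE y in \<pi>. integrable (Q y) g"
  proof eventually_elim
    case (elim y)
    then interpret Q: prob_space "Q y" by (intro prob_space_Q) simp
    show ?case
      by (rule Q.square_integrable_imp_integrable) (use elim in \<open>simp_all add: measurable_Q\<close>)
  qed
qed

text \<open>The conditional variance is nonnegative, so \<open>(Q g)\<^sup>2 \<le> Q (g\<^sup>2)\<close>.\<close>

lemma sq_int_markov_op:
  assumes "sq_int g"
  shows "sq_int (markov_op Q g)"
  unfolding sq_int_def
proof
  have g [measurable]: "g \<in> borel_measurable S" using assms by (simp add: sq_int_def)
  show "markov_op Q g \<in> borel_measurable S" by measurable
  show "integrable \<pi> (\<lambda>y. (markov_op Q g y)\<^sup>2)"
  proof (rule Bochner_Integration.integrable_bound[OF sq_int_Q(2)[OF assms]])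
    show "(\<lambda>y. (markov_op Q g y)\<^sup>2) \<in> borel_measurable \<pi>" unfolding measurable_pi by measurable
    show "AE y in \<pi>. norm ((markov_op Q g y)\<^sup>2) \<le> norm (\<integral>z. (g z)\<^sup>2 \<partial>Q y)"
      using sq_int_Q(1)[OF assms] AE_space
    proof eventually_elim
      case (elim y)
      then show ?case
        using integrable_step_var(2)[OF g, of y] step_var_nonneg[of Q g y] by simp
    qed
  qed
qed

lemma sq_int_funpow: "sq_int g \<Longrightarrow> sq_int ((markov_op Q ^^ j) g)"
  by (induction j) (auto intro: sq_int_markov_op)

lemma sq_int_add:
  assumes "sq_int g" "sq_int h"
  shows "sq_int (\<lambda>x. g x + h x)"
  unfolding sq_int_def
proof
  have [measurable]: "g \<in> borel_measurable S" "h \<in> borel_measurable S"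
    and int: "integrable \<pi> (\<lambda>x. 2 * (g x)\<^sup>2 + 2 * (h x)\<^sup>2)"
    using assms by (auto simp: sq_int_def)
  show "(\<lambda>x. g x + h x) \<in> borel_measurable S" by measurable
  show "integrable \<pi> (\<lambda>x. (g x + h x)\<^sup>2)"
  proof (rule Bochner_Integration.integrable_bound[OF int])
    show "(\<lambda>x. (g x + h x)\<^sup>2) \<in> borel_measurable \<pi>" unfolding measurable_pi by measurable
    have "(a + b)\<^sup>2 \<le> 2 * a\<^sup>2 + 2 * b\<^sup>2" for a b :: real
      using zero_le_power2[of "a - b"] by (simp add: power2_eq_square algebra_simps)
    then show "AE x in \<pi>. norm ((g x + h x)\<^sup>2) \<le> norm (2 * (g x)\<^sup>2 + 2 * (h x)\<^sup>2)"
      by (intro AE_I2) simp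
  qed
qed

lemma sq_int_sum:
  assumes "finite I" "\<And>i. i \<in> I \<Longrightarrow> sq_int (g i)"
  shows "sq_int (\<lambda>x. \<Sum>i\<in>I. g i x)"
  using assms
proof (induction I rule: finite_induct)
  case empty
  then show ?case by (simp add: sq_int_def)
next
  case (insert i I)
  then show ?case by (simp add: sq_int_add)
qed

lemma sq_int_divide: "sq_int g \<Longrightarrow> sq_int (\<lambda>x. g x / c)"
  by (auto simp: sq_int_def power_divide)

lemma integrable_step_var_pi:
  assumes g: "sq_int g"
  shows "integrable \<pi> (step_var Q g)"
proof (rule Bochner_Integration.integrable_bound[OF sq_int_Q(2)[OF g]])
  have g_meas [measurable]: "g \<in> borel_measurable S" using g by (simp add: sq_int_def)
  show "step_var Q g \<in> borel_measurable \<pi>" unfolding measurable_pi by measurable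
  show "AE y in \<pi>. norm (step_var Q g y) \<le> norm (\<integral>z. (g z)\<^sup>2 \<partial>Q y)"
    using sq_int_Q(1)[OF g] AE_space
  proof eventually_elim
    case (elim y)
    then show ?case
      using integrable_step_var(2)[OF g_meas, of y] step_var_nonneg[of Q g y] by simp
  qed
qed

text \<open>Dominated convergence is used twice: inside, for the kernel at a point, and outside, for \<open>\<pi>\<close>.\<close>

lemma step_error_pi:
  assumes g: "sq_int g"
  shows "integrable \<pi> (step_error Q g (1 / Suc N))"
    "(\<lambda>N. \<integral>y. step_error Q g (1 / Suc N) y \<partial>\<pi>) \<longlonglongrightarrow> 0"
proof -
  have g_meas [measurable]: "g \<in> borel_measurable S" using g by (simp add: sq_int_def)
  have meas: "step_error Q g (1 / Suc N) \<in> borel_measurable \<pi>" for N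
    unfolding measurable_pi by measurable
  have bound: "AE y in \<pi>. norm (step_error Q g (1 / Suc N) y) \<le> 2 * step_var Q g y" for N
    using sq_int_Q(1)[OF g] AE_space
  proof eventually_elim
    case (elim y)
    then show ?case
      using step_error_le[OF g_meas, of y "1 / Suc N"] step_error_nonneg[of "1 / Suc N" Q g y] by simp
  qed
  have int2: "integrable \<pi> (\<lambda>y. 2 * step_var Q g y)"
    using integrable_step_var_pi[OF g] by simp
  show "integrable \<pi> (step_error Q g (1 / Suc N))"
    by (rule Bochner_Integration.integrable_bound[OF int2 meas])
      (use bound[of N] in eventually_elim, simp add: step_var_nonneg)
  have "(\<lambda>N. \<integral>y. step_error Q g (1 / Suc N) y \<partial>\<pi>) \<longlonglongrightarrow> (\<integral>y. 0 \<partial>\<pi>)"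
  proof (rule integral_dominated_convergence[OF _ meas int2 _ bound])
    show "AE y in \<pi>. (\<lambda>N. step_error Q g (1 / Suc N) y) \<longlonglongrightarrow> 0"
      using sq_int_Q(1)[OF g] AE_space
    proof eventually_elim
      case (elim y)
      then have y: "y \<in> space S" by simp
      let ?d = "\<lambda>z. g z - markov_op Q g y"
      have d_meas [measurable]: "?d \<in> borel_measurable (Q y)" unfolding measurable_Q[OF y] by measurable
      have to0: "(\<lambda>N. 1 / real (Suc N)) \<longlonglongrightarrow> 0" by (rule LIMSEQ_Suc[OF lim_const_over_n])
      have "(\<lambda>N. \<integral>z. min (6 * (?d z)\<^sup>2) (1 / Suc N * \<bar>?d z\<bar> ^ 3) \<partial>Q y) \<longlonglongrightarrow> (\<integral>z. 0 \<partial>Q y)"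
      proof (rule integral_dominated_convergence[where w="\<lambda>z. 6 * (?d z)\<^sup>2"])
        show "integrable (Q y) (\<lambda>z. 6 * (?d z)\<^sup>2)"
          using integrable_step_var(1)[OF g_meas y elim(1)] by simp
        show "AE z in Q y. (\<lambda>N. min (6 * (?d z)\<^sup>2) (1 / Suc N * \<bar>?d z\<bar> ^ 3)) \<longlonglongrightarrow> 0"
        proof (rule AE_I2)
          fix z
          have "(\<lambda>N. min (6 * (?d z)\<^sup>2) (1 / Suc N * \<bar>?d z\<bar> ^ 3)) \<longlonglongrightarrow> min (6 * (?d z)\<^sup>2) (0 * \<bar>?d z\<bar> ^ 3)"
            by (intro tendsto_min tendsto_mult tendsto_const to0)
          moreover have "min (6 * (?d z)\<^sup>2) (0 * \<bar>?d z\<bar> ^ 3) = 0" by (simp add: min_absorb2)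
          ultimately show "(\<lambda>N. min (6 * (?d z)\<^sup>2) (1 / Suc N * \<bar>?d z\<bar> ^ 3)) \<longlonglongrightarrow> 0"
            by (simp only:)
        qed
        show "AE z in Q y. norm (min (6 * (?d z)\<^sup>2) (1 / Suc N * \<bar>?d z\<bar> ^ 3)) \<le> 6 * (?d z)\<^sup>2" for N
          by (intro AE_I2) (simp add: min_def)
      qed measurable
      moreover have "(\<lambda>N. min (step_var Q g y / 2) ((1 / Suc N)\<^sup>2 * (step_var Q g y)\<^sup>2 / 8)) \<longlonglongrightarrow>
          min (step_var Q g y / 2) (0\<^sup>2 * (step_var Q g y)\<^sup>2 / 8)"
        by (intro tendsto_min tendsto_divide tendsto_mult tendsto_power tendsto_const to0) simp
      ultimately have "(\<lambda>N. step_error Q g (1 / Suc N) y) \<longlonglongrightarrow> 0 / 6 + min (step_var Q g y / 2) 0"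
        unfolding step_error_def by (intro tendsto_add tendsto_divide tendsto_const) simp_all
      moreover have "0 / 6 + min (step_var Q g y / 2) 0 = 0"
        by (simp add: min_absorb2 step_var_nonneg)
      ultimately show ?case by (simp only:)
    qed
  qed simp
  then show "(\<lambda>N. \<integral>y. step_error Q g (1 / Suc N) y \<partial>\<pi>) \<longlonglongrightarrow> 0" by simp
qed

theorem quenched_martingale_clt:
  assumes g: "sq_int g"
  shows "AE x in \<pi>. \<forall>t. (\<lambda>n. \<integral>\<omega>. iexp (t / sqrt n * (\<Sum>j<n. g (\<omega> (Suc j)) - markov_op Q g (\<omega> j))) \<partial>chain_law S Q x)
    \<longlonglongrightarrow> exp (- (t\<^sup>2 * (\<integral>y. step_var Q g y \<partial>\<pi>) / 2))"
proof -
  have g_meas: "g \<in> borel_measurable S" using g by (simp add: sq_int_def)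
  have "AE x in \<pi>. \<forall>N. AE \<omega> in chain_law S Q x.
      (\<lambda>n. (\<Sum>j<n. step_error Q g (1 / Suc N) (\<omega> j)) / real n) \<longlonglongrightarrow> (\<integral>y. step_error Q g (1 / Suc N) y \<partial>\<pi>)"
    unfolding AE_all_countable by (intro allI chain_law_birkhoff step_error_pi(1) g)
  then show ?thesis
    using AE_chain_law_coordinates[OF sq_int_Q(1)[OF g]]
      chain_law_birkhoff[OF integrable_step_var_pi[OF g]] AE_space
  proof eventually_elim
    case (elim x)
    have "markov_clt S Q (chain_law S Q x) g (\<integral>y. step_var Q g y \<partial>\<pi>) (\<lambda>N. \<integral>y. step_error Q g (1 / Suc N) y \<partial>\<pi>)"
    proof unfold_locales
      show "markov_law S Q (chain_law S Q x)" using elim(4) by (intro markov_law_chain_law) simp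
      show "0 \<le> (\<integral>y. step_var Q g y \<partial>\<pi>)" by (simp add: step_var_nonneg)
    qed (use elim g_meas step_error_pi(2)[OF g] in auto)
    from markov_clt.char_martingale_tendsto[OF this] show ?case
      unfolding markov_clt.increment_def[OF \<open>markov_clt _ _ _ _ _ _\<close>] by blast
  qed
qed

text \<open>The last summand of a sum whose averages converge is of smaller order than its length.\<close>

lemma quenched_boundary_vanishes:
  assumes g: "sq_int g"
  shows "AE x in \<pi>. AE \<omega> in chain_law S Q x. (\<lambda>n. g (\<omega> n) / sqrt n) \<longlonglongrightarrow> 0"
proof -
  have "integrable \<pi> (\<lambda>y. (g y)\<^sup>2)" using g by (simp add: sq_int_def)
  from chain_law_birkhoff[OF this] show ?thesis
  proof eventually_elim
    case (elim x)
    then show ?case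
    proof eventually_elim
      case (elim \<omega>)
      let ?A = "\<lambda>n. (\<Sum>i<n. (g (\<omega> i))\<^sup>2) / real n" and ?c = "\<integral>y. (g y)\<^sup>2 \<partial>\<pi>"
      have ratio: "(\<lambda>n. real (Suc n) / real n) \<longlonglongrightarrow> 1" by (rule LIMSEQ_Suc_n_over_n)
      have "(\<lambda>n. ?A (Suc n) * (real (Suc n) / real n) - ?A n) \<longlonglongrightarrow> ?c * 1 - ?c"
        by (intro tendsto_diff tendsto_mult LIMSEQ_Suc elim ratio)
      then have "(\<lambda>n. ?A (Suc n) * (real (Suc n) / real n) - ?A n) \<longlonglongrightarrow> 0" by simp
      moreover have "\<forall>\<^sub>F n in sequentially. ?A (Suc n) * (real (Suc n) / real n) - ?A n = (g (\<omega> n))\<^sup>2 / real n"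
        using eventually_gt_at_top[of 0]
        by eventually_elim (simp add: diff_divide_distrib[symmetric] del: of_nat_Suc)
      ultimately have "(\<lambda>n. (g (\<omega> n))\<^sup>2 / real n) \<longlonglongrightarrow> 0"
        by (rule Lim_transform_eventually)
      then have "(\<lambda>n. sqrt ((g (\<omega> n))\<^sup>2 / real n)) \<longlonglongrightarrow> sqrt 0" by (rule tendsto_real_sqrt)
      then have "(\<lambda>n. \<bar>g (\<omega> n) / sqrt n\<bar>) \<longlonglongrightarrow> 0" by (simp add: real_sqrt_divide abs_divide)
      then show ?case by (rule tendsto_rabs_zero_cancel)
    qed
  qed
qed

section \<open>The Poisson equation and the quenched central limit theorem\<close>

text \<open>The solution \<open>\<theta>\<close> of the Poisson equation \<open>\<theta> - Q \<theta> = f - avg Q f m\<close>. Solving for \<open>f\<close> minus an average, and not for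
\<open>f\<close> itself, needs only finitely many iterates of \<open>Q\<close>.\<close>

definition corrector :: "('a \<Rightarrow> real) \<Rightarrow> nat \<Rightarrow> 'a \<Rightarrow> real" where
  "corrector f m x = (\<Sum>i=1..m. \<Sum>j<i. (markov_op Q ^^ j) f x) / real m"

lemma sq_int_corrector: "sq_int f \<Longrightarrow> sq_int (corrector f m)"
  unfolding corrector_def[abs_def] by (intro sq_int_divide sq_int_sum sq_int_funpow) auto

lemma poisson_equation:
  assumes f: "sq_int f" and m: "0 < m"
  shows "AE y in \<pi>. corrector f m y - markov_op Q (corrector f m) y = f y - avg Q f m y"
proof -
  have "AE y in \<pi>. \<forall>j. integrable (Q y) ((markov_op Q ^^ j) f)"
    unfolding AE_all_countable by (intro allI sq_int_Q(3) sq_int_funpow f)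
  then show ?thesis
  proof eventually_elim
    case (elim y)
    then have int: "integrable (Q y) ((markov_op Q ^^ j) f)" for j by blast
    have telescope: "(\<Sum>j<i. (markov_op Q ^^ j) f y - (markov_op Q ^^ Suc j) f y) = f y - (markov_op Q ^^ i) f y" for i
      using sum_lessThan_telescope'[of "\<lambda>j. (markov_op Q ^^ j) f y" i] by simp
    have "markov_op Q (corrector f m) y = (\<integral>z. (\<Sum>i=1..m. \<Sum>j<i. (markov_op Q ^^ j) f z) / real m \<partial>Q y)"
      by (simp add: markov_op_def corrector_def[abs_def])
    also have "\<dots> = (\<Sum>i=1..m. \<Sum>j<i. (\<integral>z. (markov_op Q ^^ j) f z \<partial>Q y)) / real m"
      by (simp add: Bochner_Integration.integral_sum Bochner_Integration.integrable_sum int)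
    also have "\<dots> = (\<Sum>i=1..m. \<Sum>j<i. (markov_op Q ^^ Suc j) f y) / real m"
      by (simp add: markov_op_def)
    finally have "markov_op Q (corrector f m) y = (\<Sum>i=1..m. \<Sum>j<i. (markov_op Q ^^ Suc j) f y) / real m" .
    then have "corrector f m y - markov_op Q (corrector f m) y =
        (\<Sum>i=1..m. \<Sum>j<i. (markov_op Q ^^ j) f y - (markov_op Q ^^ Suc j) f y) / real m"
      by (simp add: corrector_def sum_subtractf diff_divide_distrib)
    also have "\<dots> = (\<Sum>i=1..m. f y - (markov_op Q ^^ i) f y) / real m"
      by (simp only: telescope)
    also have "\<dots> = f y - avg Q f m y"
      using m by (simp add: avg_def sum_subtractf diff_divide_distrib)
    finally show ?case .
  qed
qed

lemma quenched_approximation: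
  assumes f: "sq_int f" and m: "0 < m"
  defines "\<theta> \<equiv> corrector f m"
  shows "AE x in \<pi>. AE \<omega> in chain_law S Q x.
    (\<lambda>n. (\<Sum>j<n. \<theta> (\<omega> (Suc j)) - markov_op Q \<theta> (\<omega> j)) / sqrt n -
      (partial_sum f n \<omega> / sqrt n - partial_sum (avg Q f m) n \<omega> / sqrt n)) \<longlonglongrightarrow> 0"
proof -
  have \<theta>: "sq_int \<theta>" unfolding \<theta>_def by (rule sq_int_corrector[OF f])
  show ?thesis
    using AE_chain_law_coordinates[OF poisson_equation[OF f m]]
      quenched_boundary_vanishes[OF sq_int_markov_op[OF \<theta>]]
  proof eventually_elim
    case (elim x)
    from elim show ?case
    proof eventually_elim
      case (elim \<omega>)
      have shift: "partial_sum h n \<omega> = (\<Sum>j<n. h (\<omega> (Suc j)))" for h :: "'a \<Rightarrow> real" and n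
        unfolding partial_sum_def by (rule sum.reindex_bij_witness[of _ Suc "\<lambda>i. i - 1"]) auto
      have "partial_sum f n \<omega> - partial_sum (avg Q f m) n \<omega> = (\<Sum>j<n. \<theta> (\<omega> (Suc j)) - markov_op Q \<theta> (\<omega> (Suc j)))" for n
        unfolding shift sum_subtractf[symmetric] \<theta>_def using elim(1) by simp
      then have "(\<Sum>j<n. \<theta> (\<omega> (Suc j)) - markov_op Q \<theta> (\<omega> j)) - (partial_sum f n \<omega> - partial_sum (avg Q f m) n \<omega>) =
          (\<Sum>j<n. markov_op Q \<theta> (\<omega> (Suc j)) - markov_op Q \<theta> (\<omega> j))" for n
        by (simp add: sum_subtractf)
      then have eq: "(\<Sum>j<n. \<theta> (\<omega> (Suc j)) - markov_op Q \<theta> (\<omega> j)) - (partial_sum f n \<omega> - partial_sum (avg Q f m) n \<omega>) =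
          markov_op Q \<theta> (\<omega> n) - markov_op Q \<theta> (\<omega> 0)" for n
        by (simp add: sum_lessThan_telescope[of "\<lambda>j. markov_op Q \<theta> (\<omega> j)"])
      have "(\<lambda>n. markov_op Q \<theta> (\<omega> 0) / sqrt (real n)) \<longlonglongrightarrow> 0"
        by (intro tendsto_divide_0[OF tendsto_const] filterlim_at_top_imp_at_infinity
            filterlim_compose[OF sqrt_at_top filterlim_real_sequentially])
      from tendsto_diff[OF elim(2) this] show ?case
        by (simp only: diff_divide_distrib[symmetric] eq diff_zero)
    qed
  qed
qed

end

text \<open>The limit is written as the image of the standard normal law under scaling, so that \<open>L = 0\<close> yields the point
mass at \<open>0\<close>.\<close>

lemma weak_conv_gaussian_of_char:
  fixes Y :: "nat \<Rightarrow> 'a \<Rightarrow> real"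
  assumes M: "prob_space M" and Y: "\<And>n. Y n \<in> borel_measurable M" and L: "0 \<le> L"
    and char: "\<And>t. (\<lambda>n. \<integral>\<omega>. iexp (t * Y n \<omega>) \<partial>M) \<longlonglongrightarrow> complex_of_real (exp (- (t\<^sup>2 * L / 2)))"
  shows "weak_conv_m (\<lambda>n. distr M borel (Y n)) (distr std_normal_distribution borel (\<lambda>z. sqrt L * z))"
proof (rule levy_continuity)
  interpret prob_space M by fact
  interpret N: prob_space std_normal_distribution by (rule prob_space_normal_density) simp
  show "real_distribution (distr M borel (Y n))" for n
    by (rule real_distribution_distr) (rule Y)
  show "real_distribution (distr std_normal_distribution borel (\<lambda>z. sqrt L * z))"
    by (rule N.real_distribution_distr) simp
  fix t
  have "char (distr std_normal_distribution borel (\<lambda>z. sqrt L * z)) t = char std_normal_distribution (t * sqrt L)"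
    unfolding char_def by (subst integral_distr) (simp_all add: mult_ac)
  also have "\<dots> = exp (- (t\<^sup>2 * L / 2))"
    using L by (simp add: char_std_normal_distribution power_mult_distrib)
  finally have "char (distr std_normal_distribution borel (\<lambda>z. sqrt L * z)) t = exp (- (t\<^sup>2 * L / 2))" .
  moreover have "char (distr M borel (Y n)) t = (\<integral>\<omega>. iexp (t * Y n \<omega>) \<partial>M)" for n
    unfolding char_def by (rule integral_distr[OF Y]) measurable
  ultimately show "(\<lambda>n. char (distr M borel (Y n)) t) \<longlonglongrightarrow> char (distr std_normal_distribution borel (\<lambda>z. sqrt L * z)) t"
    using char[of t] by simp
qed

theorem theorem1:
  fixes P :: "(int \<Rightarrow> 'a) measure" and S \<pi> :: "'a measure" and Q :: "'a \<Rightarrow> 'a measure"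
    and f :: "'a \<Rightarrow> real"
  assumes "stationary_ergodic_markov_chain P S \<pi> Q"
    and "f \<in> L2_0 \<pi>"
    and "\<And>\<epsilon>::real. \<epsilon> > 0 \<Longrightarrow>
      AE x in \<pi>.
        (\<lambda>m. limsup (\<lambda>n. emeasure (chain_law S Q x)
           {\<omega> \<in> space (chain_law S Q x). \<bar>partial_sum (avg Q f m) n \<omega>\<bar> / sqrt (real n) > \<epsilon>}))
        \<longlonglongrightarrow> 0"
  shows "\<exists>\<sigma>\<ge>0. \<exists>S'\<in>sets S. emeasure \<pi> S' = 1 \<and>
    (\<forall>x\<in>S'. weak_conv_m
      (\<lambda>n. distr (chain_law S Q x) borel (\<lambda>\<omega>. partial_sum f n \<omega> / sqrt (real n)))
      (distr std_normal_distribution borel (\<lambda>z. \<sigma> * z)))"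
proof -
  interpret stationary_ergodic_markov_chain P S \<pi> Q by fact
  have f: "sq_int f" using assms(2) by (simp add: L2_0_def sq_int_def measurable_pi)
  have f_meas [measurable]: "f \<in> borel_measurable S" using f by (simp add: sq_int_def)
  have iter [measurable]: "(markov_op Q ^^ i) f \<in> borel_measurable S" for i
    using sq_int_funpow[OF f] by (simp add: sq_int_def)
  have avg_meas [measurable]: "avg Q f m \<in> borel_measurable S" for m
    unfolding avg_def[abs_def] by measurable
  have ps_meas: "partial_sum g n \<in> borel_measurable paths" if [measurable]: "g \<in> borel_measurable S" for g :: "'a \<Rightarrow> real" and n
    unfolding partial_sum_def[abs_def] by measurable
  \<comment> \<open>The averages are indexed from \<open>Suc m\<close>, since the Poisson equation fails for the empty average.\<close>
  define \<theta> where "\<theta> m = corrector f (Suc m)" for m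
  define s where "s m = (\<integral>y. step_var Q (\<theta> m) y \<partial>\<pi>)" for m
  define Y where "Y n \<omega> = partial_sum f n \<omega> / sqrt (real n)" for n and \<omega> :: "nat \<Rightarrow> 'a"
  \<comment> \<open>\<open>Y - Z\<close> is the normalized remainder of the hypothesis exactly, while \<open>Z\<close> differs from the martingale \<open>X\<close> only
    by boundary terms.\<close>
  define Z where "Z m n \<omega> = Y n \<omega> - partial_sum (avg Q f (Suc m)) n \<omega> / sqrt (real n)" for m n and \<omega> :: "nat \<Rightarrow> 'a"
  define X where "X m n \<omega> = (\<Sum>j<n. \<theta> m (\<omega> (Suc j)) - markov_op Q (\<theta> m) (\<omega> j)) / sqrt (real n)"
    for m n and \<omega> :: "nat \<Rightarrow> 'a"
  have \<theta>: "sq_int (\<theta> m)" for m unfolding \<theta>_def by (rule sq_int_corrector[OF f])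
  then have \<theta>_meas [measurable]: "\<theta> m \<in> borel_measurable S" for m by (simp add: sq_int_def)
  have Y_meas: "Y n \<in> borel_measurable paths" for n
    unfolding Y_def[abs_def] by (intro borel_measurable_divide ps_meas borel_measurable_const) simp
  have Z_meas: "Z m n \<in> borel_measurable paths" for m n
    unfolding Z_def[abs_def]
    by (intro borel_measurable_diff borel_measurable_divide Y_meas ps_meas borel_measurable_const) simp
  have X_meas: "X m n \<in> borel_measurable paths" for m n
    unfolding X_def[abs_def] by measurable
  have s0: "0 \<le> s m" for m by (simp add: s_def step_var_nonneg)

  define good where "good x \<longleftrightarrow> x \<in> space S \<and>
    (\<forall>m t. (\<lambda>n. \<integral>\<omega>. iexp (t * X m n \<omega>) \<partial>chain_law S Q x) \<longlonglongrightarrow> complex_of_real (exp (- (t\<^sup>2 * s m / 2)))) \<and>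
    (\<forall>m. AE \<omega> in chain_law S Q x. (\<lambda>n. X m n \<omega> - Z m n \<omega>) \<longlonglongrightarrow> 0) \<and>
    (\<forall>k. (\<lambda>m. limsup (\<lambda>n. emeasure (chain_law S Q x)
      {\<omega> \<in> space (chain_law S Q x). \<bar>partial_sum (avg Q f m) n \<omega>\<bar> / sqrt (real n) > 1 / Suc k})) \<longlonglongrightarrow> 0)" for x
  have "AE x in \<pi>. x \<in> space S" using AE_space[of \<pi>] by simp
  moreover have "AE x in \<pi>. \<forall>m t. (\<lambda>n. \<integral>\<omega>. iexp (t * X m n \<omega>) \<partial>chain_law S Q x) \<longlonglongrightarrow> complex_of_real (exp (- (t\<^sup>2 * s m / 2)))"
    unfolding AE_all_countable X_def s_def using quenched_martingale_clt[OF \<theta>] by (simp add: field_simps)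
  moreover have "AE x in \<pi>. \<forall>m. AE \<omega> in chain_law S Q x. (\<lambda>n. X m n \<omega> - Z m n \<omega>) \<longlonglongrightarrow> 0"
    unfolding AE_all_countable X_def Z_def Y_def \<theta>_def by (intro allI quenched_approximation f) simp
  moreover have "AE x in \<pi>. \<forall>k. (\<lambda>m. limsup (\<lambda>n. emeasure (chain_law S Q x)
      {\<omega> \<in> space (chain_law S Q x). \<bar>partial_sum (avg Q f m) n \<omega>\<bar> / sqrt (real n) > 1 / Suc k})) \<longlonglongrightarrow> 0"
    unfolding AE_all_countable by (intro allI assms(3)) simp
  ultimately have "AE x in \<pi>. good x"
    unfolding good_def by eventually_elim blast
  then obtain N where N: "N \<in> null_sets \<pi>" "{x \<in> space \<pi>. \<not> good x} \<subseteq> N"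
    by (auto simp: eventually_ae_filter)
  define S' where "S' = space S - N"
  have S': "S' \<in> sets S" using N(1) by (auto simp: S'_def)
  have good: "good x" if "x \<in> S'" for x using that N(2) by (auto simp: S'_def)
  have one: "emeasure \<pi> S' = 1"
    using emeasure_Diff_null_set[OF N(1), of "space \<pi>"] pi.emeasure_space_1 by (simp add: S'_def)

  have limit: "\<exists>L\<ge>0. s \<longlonglongrightarrow> L \<and> (\<forall>t. (\<lambda>n. \<integral>\<omega>. iexp (t * Y n \<omega>) \<partial>chain_law S Q x) \<longlonglongrightarrow> complex_of_real (exp (- (t\<^sup>2 * L / 2))))"
    if "x \<in> S'" for x
  proof -
    have gx: "good x" by (rule good[OF that])
    then have x: "x \<in> space S" by (simp add: good_def)
    interpret Px: prob_space "chain_law S Q x" by (rule prob_space_chain_law[OF x])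
    note meas = Y_meas X_meas Z_meas
    show ?thesis
    proof (rule Px.gaussian_char_of_approximation[where Z=Z])
      show "Y n \<in> borel_measurable (chain_law S Q x)" "Z m n \<in> borel_measurable (chain_law S Q x)" for m n
        using meas by (simp_all add: measurable_chain_law x)
      show "0 \<le> s m" for m by (rule s0)
      show "(\<lambda>n. \<integral>\<omega>. iexp (t * Z m n \<omega>) \<partial>chain_law S Q x) \<longlonglongrightarrow> complex_of_real (exp (- (t\<^sup>2 * s m / 2)))" for m t
        using gx unfolding good_def
        by (intro Px.char_tendsto_of_AE_close[where X="X m" and Y="Z m"]) (simp_all add: meas measurable_chain_law x)
      show "(\<lambda>m. limsup (\<lambda>n. emeasure (chain_law S Q x) {\<omega>\<in>space (chain_law S Q x). \<bar>Y n \<omega> - Z m n \<omega>\<bar> > 1 / Suc k})) \<longlonglongrightarrow> 0" for k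
      proof -
        have "\<bar>Y n \<omega> - Z m n \<omega>\<bar> = \<bar>partial_sum (avg Q f (Suc m)) n \<omega>\<bar> / sqrt (real n)" for m n \<omega>
          by (simp add: Z_def abs_divide)
        then show ?thesis using gx LIMSEQ_Suc unfolding good_def by (simp only:) blast
      qed
    qed
  qed
  obtain x0 where "x0 \<in> S'" using one by fastforce
  from limit[OF this] obtain L where L: "0 \<le> L" "s \<longlonglongrightarrow> L" by blast
  show ?thesis
  proof (intro exI[of _ "sqrt L"] conjI bexI[of _ S'] S' one ballI)
    show "0 \<le> sqrt L" using L by simp
    fix x assume x: "x \<in> S'"
    then have xS: "x \<in> space S" by (simp add: S'_def)
    from limit[OF x] L(2) have "\<forall>t. (\<lambda>n. \<integral>\<omega>. iexp (t * Y n \<omega>) \<partial>chain_law S Q x) \<longlonglongrightarrow> complex_of_real (exp (- (t\<^sup>2 * L / 2)))"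
      using LIMSEQ_unique by blast
    then have "weak_conv_m (\<lambda>n. distr (chain_law S Q x) borel (Y n)) (distr std_normal_distribution borel (\<lambda>z. sqrt L * z))"
      using Y_meas by (intro weak_conv_gaussian_of_char prob_space_chain_law xS L(1)) (simp_all add: measurable_chain_law xS)
    then show "weak_conv_m (\<lambda>n. distr (chain_law S Q x) borel (\<lambda>\<omega>. partial_sum f n \<omega> / sqrt (real n)))
      (distr std_normal_distribution borel (\<lambda>z. sqrt L * z))"
      by (simp add: Y_def[abs_def])
  qed
qed

end
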